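(* There exists $n_0\in\mathbb{N}$ such that for every integer $n\ge n_0$ and every $0<\alpha<1$ the following holds. For every $\varepsilon>0$ there exist a function $\varpi_\varepsilon\in W^{1,\infty}([0,\infty))$, a real number $\lambda^\varepsilon$, and a function $h_n^\varepsilon\in C^\infty(\operatorname{supp}(\partial_r\varpi_\varepsilon))$, not identically zero, such that $$(\lambda^\varepsilon+c(r))\,h_n^\varepsilon(r)-\frac1n\int_0^\infty \partial_s\varpi_\varepsilon(s)\,K_n\!\left(\frac rs\right)h_n^\varepsilon(s)\,ds=0\qquad\text{for all } r\in\operatorname{supp}(\partial_r\varpi_\varepsilon),$$ where $c(r)=\int_0^\infty \partial_s\varpi_\varepsilon(s)\,K_1\!\left(\frac rs\right)ds$, and $$\left\|(1+r^2)^{-1}-\varpi_\varepsilon\right\|_{C^\alpha([0,\infty))}\le\varepsilon .$$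
   Context: For $n\in\mathbb{N}$ the kernel $K_n$ is $$K_n(\rho)=\frac{1}{2\rho}\begin{cases}\rho^{-n}, & \rho>1,\\ \rho^{n}, & \rho\le 1,\end{cases}$$ (at $\rho=0$ understood as the limit $\rho\to0^+$). $\|f\|_{C^\alpha}=\|f\|_{L^\infty}+\sup_{r\ne s}\frac{|f(r)-f(s)|}{|r-s|^\alpha}$. In the integral, $h_n^\varepsilon$ is only needed on $\operatorname{supp}(\partial_r\varpi_\varepsilon)$, and the integrals are required to converge. Smoothness on the closed set $\operatorname{supp}(\partial_r\varpi_\varepsilon)$ means smoothness up to the boundary. (Meaning: $w(r,\theta,t)=h_n^\varepsilon(r)\,\partial_r\varpi_\varepsilon(r)\cos(n(\theta-\lambda^\varepsilon t))$ is then a time-periodic non-radial solution of the 2D Euler equation in vorticity form linearized around the radial vortex $\varpi_\varepsilon$.) *)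

theory Defs
  imports "HOL-Analysis.Analysis"
begin

definition kernel_K :: "nat \<Rightarrow> real \<Rightarrow> real" where
  "kernel_K n \<rho> =
    (if \<rho> > 1 then 1 / (2 * \<rho>) * \<rho> powi (- int n)
     else if \<rho> > 0 then 1 / (2 * \<rho>) * \<rho> ^ n
     else Lim (at_right 0) (\<lambda>x. 1 / (2 * x) * x ^ n))"

(* The norm of C^alpha([0,\<infinity>)). It is extended-valued, so a finite bound on it asserts
   membership in the space. The sup norm is the supremum over all points; it agrees with the
   essential supremum as soon as the Hoelder seminorm is finite. *)
definition holder_norm :: "real \<Rightarrow> (real \<Rightarrow> real) \<Rightarrow> ennreal" where
  "holder_norm \<alpha> f =
     (SUP r\<in>{0..}. ennreal \<bar>f r\<bar>) +
     (SUP (r, s)\<in>{(r, s). 0 \<le> r \<and> 0 \<le> s \<and> r \<noteq> s}.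
        ennreal (\<bar>f r - f s\<bar> / \<bar>r - s\<bar> powr \<alpha>))"

(* Meant for open U only, where the iterated derivatives at x depend only on f near x. *)
definition smooth_on_open :: "real set \<Rightarrow> (real \<Rightarrow> real) \<Rightarrow> bool" where
  "smooth_on_open U f \<longleftrightarrow>
     open U \<and> (\<forall>k. \<forall>x\<in>U. (deriv ^^ k) f field_differentiable (at x))"

(* Smoothness up to the boundary on an arbitrary closed set: near the set, f is the
   restriction of a smooth function. *)
definition C_infinity :: "real set \<Rightarrow> (real \<Rightarrow> real) set" where
  "C_infinity S =
     {f. \<exists>U F. S \<subseteq> U \<and> smooth_on_open U F \<and> (\<forall>x\<in>S. F x = f x)}"

definition test_function :: "(real \<Rightarrow> real) \<Rightarrow> bool" where
  "test_function \<phi> \<longleftrightarrow>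
     smooth_on_open UNIV \<phi> \<and>
     (\<exists>C. compact C \<and> C \<subseteq> {0<..} \<and> (\<forall>x. x \<notin> C \<longrightarrow> \<phi> x = 0))"

definition locally_integrable :: "(real \<Rightarrow> real) \<Rightarrow> bool" where
  "locally_integrable f \<longleftrightarrow>
     (\<forall>C. compact C \<and> C \<subseteq> {0<..} \<longrightarrow> set_integrable lebesgue C f)"

(* The weak derivative is determined only almost everywhere, so it is a relation:
   g is a representative of the weak derivative of f on (0,\<infinity>). *)
definition has_weak_derivative :: "(real \<Rightarrow> real) \<Rightarrow> (real \<Rightarrow> real) \<Rightarrow> bool" where
  "has_weak_derivative f g \<longleftrightarrow>
     locally_integrable f \<and> locally_integrable g \<and>
     (\<forall>\<phi>. test_function \<phi> \<longrightarrow>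
        (LINT r:{0<..}|lebesgue. f r * deriv \<phi> r) = - (LINT r:{0<..}|lebesgue. g r * \<phi> r))"

definition L_infinity :: "(real \<Rightarrow> real) set" where
  "L_infinity =
     {f. f \<in> borel_measurable (lebesgue_on {0..}) \<and>
         (\<exists>C. AE r in lebesgue_on {0..}. \<bar>f r\<bar> \<le> C)}"

definition W_1_infinity :: "(real \<Rightarrow> real) set" where
  "W_1_infinity = {f \<in> L_infinity. \<exists>g\<in>L_infinity. has_weak_derivative f g}"

(* The support of an almost everywhere class on [0,\<infinity>): the complement of the largest
   relatively open set on which g vanishes almost everywhere. It does not depend on the
   representative g. *)
definition ess_support :: "(real \<Rightarrow> real) \<Rightarrow> real set" where
  "ess_support g =
     {r\<in>{0..}. \<forall>U. open U \<and> r \<in> U \<longrightarrow>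
        \<not> (AE s in lebesgue_on {0..}. s \<in> U \<longrightarrow> g s = 0)}"

(* In the following, g stands for the derivative of the vorticity profile. The integrals
   are Lebesgue integrals; the value of r / s at s = 0 is irrelevant. Values of h outside
   ess_support g do not matter, since g vanishes almost everywhere there. *)
definition c_integrand :: "(real \<Rightarrow> real) \<Rightarrow> real \<Rightarrow> real \<Rightarrow> real" where
  "c_integrand g r s = g s * kernel_K 1 (r / s)"

definition c_coeff :: "(real \<Rightarrow> real) \<Rightarrow> real \<Rightarrow> real" where
  "c_coeff g r = (LINT s:{0..}|lebesgue. c_integrand g r s)"

definition interaction_integrand ::
    "nat \<Rightarrow> (real \<Rightarrow> real) \<Rightarrow> (real \<Rightarrow> real) \<Rightarrow> real \<Rightarrow> real \<Rightarrow> real" where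
  "interaction_integrand n g h r s = g s * kernel_K n (r / s) * h s"

definition interaction ::
    "nat \<Rightarrow> (real \<Rightarrow> real) \<Rightarrow> (real \<Rightarrow> real) \<Rightarrow> real \<Rightarrow> real" where
  "interaction n g h r = (LINT s:{0..}|lebesgue. interaction_integrand n g h r s)"

end

theory Submission
  imports Defs "HOL-Real_Asymp.Real_Asymp"
begin

text \<open>
  Freeze the vorticity at its values at \<open>a\<close> and \<open>b\<close> outside \<open>[a, b]\<close>, with \<open>a\<close> small and \<open>b\<close> large.
  The difference to the original profile is small in the sup norm with bounded Lipschitz constant, hence
  small in every Hoelder norm. Let \<open>\<Omega>\<close> be the angular velocity and \<open>F = \<Omega> - lam\<close> with
  \<open>lam = \<Omega>(R0)\<close> for some \<open>R0 > b\<close>; then \<open>F > 0\<close> on the support of the vorticity gradient and the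
  equation is Rayleigh's equation for the stream function \<open>\<psi> = r F h\<close>. In terms of \<open>h\<close> it reads
  \<open>(r\<^sup>3 F\<^sup>2 h')' = (n\<^sup>2 - 1) r F\<^sup>2 h\<close>, whose solution starting from \<open>\<psi> = r^n\<close> at \<open>a\<close> stays positive.
  It solves the integral equation if it matches a decaying exterior solution at \<open>b\<close>, that is, if
  \<open>r \<psi>' + n \<psi> = 0\<close> there. Instead of tuning \<open>lam\<close>, fix \<open>R0\<close>, solve the equation for the profile
  frozen only near the origin, on all of \<open>[a, R0)\<close>, and choose \<open>b\<close> as a zero of \<open>r \<psi>' + n \<psi>\<close>. This
  quantity is positive as long as \<open>vort > 2 lam\<close>, which forces \<open>b\<close> to be large, and it tends to
  \<open>-\<infinity>\<close> at \<open>R0\<close> unless it vanishes before, because \<open>1 / F\<close> is not integrable at \<open>R0\<close>.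
\<close>

section \<open>Smooth functions\<close>

text \<open>The derivatives are witnesses on \<open>U\<close> rather than iterates of
  \<open>deriv\<close>, so that closure under sums, products and inverses follows by induction on
  the order from the usual derivative rules.\<close>

primrec diff_times :: "nat \<Rightarrow> real set \<Rightarrow> (real \<Rightarrow> real) \<Rightarrow> bool" where
  "diff_times 0 U f \<longleftrightarrow> True"
| "diff_times (Suc k) U f \<longleftrightarrow>
     (\<exists>f'. (\<forall>x\<in>U. (f has_real_derivative f' x) (at x)) \<and> diff_times k U f')"

lemma diff_times_SucI:
  assumes "\<And>x. x \<in> U \<Longrightarrow> (f has_real_derivative f' x) (at x)" "diff_times k U f'"
  shows "diff_times (Suc k) U f"
  using assms by auto

lemma diff_times_Suc_imp: "diff_times (Suc k) U f \<Longrightarrow> diff_times k U f"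
proof (induction k arbitrary: f)
  case (Suc k)
  then obtain f' where "\<forall>x\<in>U. (f has_real_derivative f' x) (at x)" "diff_times (Suc k) U f'"
    by auto
  with Suc.IH show ?case by (intro diff_times_SucI) auto
qed simp

lemma diff_times_const: "diff_times k U (\<lambda>x. c)"
proof (induction k arbitrary: c)
  case (Suc k)
  show ?case by (rule diff_times_SucI[where f' = "\<lambda>x. 0"]) (use Suc in auto)
qed simp

lemma diff_times_ident: "diff_times k U (\<lambda>x. x)"
proof (cases k)
  case (Suc j)
  show ?thesis unfolding Suc
    by (rule diff_times_SucI[where f' = "\<lambda>x. 1"]) (use diff_times_const in auto)
qed simp

lemma diff_times_add:
  "diff_times k U f \<Longrightarrow> diff_times k U g \<Longrightarrow> diff_times k U (\<lambda>x. f x + g x)"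
proof (induction k arbitrary: f g)
  case (Suc k)
  then obtain f' g' where
    "\<forall>x\<in>U. (f has_real_derivative f' x) (at x)" "diff_times k U f'"
    "\<forall>x\<in>U. (g has_real_derivative g' x) (at x)" "diff_times k U g'"
    by auto
  with Suc.IH show ?case
    by (intro diff_times_SucI[where f' = "\<lambda>x. f' x + g' x"]) (auto intro: DERIV_add)
qed simp

lemma diff_times_mult:
  "diff_times k U f \<Longrightarrow> diff_times k U g \<Longrightarrow> diff_times k U (\<lambda>x. f x * g x)"
proof (induction k arbitrary: f g)
  case (Suc k)
  then obtain f' g' where
    der: "\<forall>x\<in>U. (f has_real_derivative f' x) (at x)" "\<forall>x\<in>U. (g has_real_derivative g' x) (at x)"
    and reg: "diff_times k U f'" "diff_times k U g'"
    by auto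
  have "diff_times k U f" "diff_times k U g"
    using Suc.prems by (blast intro: diff_times_Suc_imp)+
  then have "diff_times k U (\<lambda>x. f' x * g x + g' x * f x)"
    using reg Suc.IH by (intro diff_times_add) auto
  then show ?case
    by (rule diff_times_SucI[rotated]) (use der in \<open>auto intro: DERIV_mult\<close>)
qed simp

lemma diff_times_power:
  "diff_times k U f \<Longrightarrow> diff_times k U (\<lambda>x. f x ^ m)"
  by (induction m) (auto intro: diff_times_const diff_times_mult)

lemma diff_times_inverse:
  assumes "diff_times k U f" "\<And>x. x \<in> U \<Longrightarrow> f x \<noteq> 0"
  shows "diff_times k U (\<lambda>x. inverse (f x))"
  using assms(1)
proof (induction k)
  case (Suc k)
  then obtain f' where der: "\<forall>x\<in>U. (f has_real_derivative f' x) (at x)" and reg: "diff_times k U f'"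
    by auto
  have "diff_times k U (\<lambda>x. inverse (f x))"
    using Suc by (blast intro: diff_times_Suc_imp)
  then have "diff_times k U (\<lambda>x. (-1) * f' x * inverse (f x) ^ 2)"
    by (intro diff_times_mult diff_times_power diff_times_const reg)
  then show ?case
  proof (rule diff_times_SucI[rotated])
    fix x assume "x \<in> U"
    with der assms(2) show "((\<lambda>x. inverse (f x)) has_real_derivative (-1) * f' x * inverse (f x) ^ 2) (at x)"
      by (auto intro!: derivative_eq_intros simp: power2_eq_square)
  qed
qed simp

text \<open>The witnessed derivatives agree with the iterates of \<open>deriv\<close> only on
  \<open>U\<close>. Since \<open>U\<close> is open, a derivative at a point of \<open>U\<close>
  carries over from one to the other.\<close>

lemma smooth_on_openI:
  assumes "open U" and f: "\<And>k. diff_times k U f"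
  shows "smooth_on_open U f"
proof -
  have "\<exists>g. (\<forall>x\<in>U. (deriv ^^ k) f x = g x) \<and> diff_times j U g"
    if "diff_times (k + j) U f" for k j
    using that
  proof (induction k arbitrary: j)
    case (Suc k)
    have "diff_times (k + Suc j) U f"
      using Suc.prems by (simp only: add_Suc add_Suc_right)
    from Suc.IH[OF this] obtain g where g: "\<forall>x\<in>U. (deriv ^^ k) f x = g x" "diff_times (Suc j) U g"
      by blast
    then obtain g' where g': "\<forall>x\<in>U. (g has_real_derivative g' x) (at x)" "diff_times j U g'"
      by auto
    have "(deriv ^^ Suc k) f x = g' x" if "x \<in> U" for x
    proof -
      have "((deriv ^^ k) f has_real_derivative g' x) (at x)"
        by (rule has_field_derivative_transform_within_open[of g _ x U]) (use g g' that \<open>open U\<close> in simp_all)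
      then show ?thesis by (simp add: DERIV_imp_deriv)
    qed
    with g' show ?case by blast
  qed auto
  note ex = this
  have "(deriv ^^ k) f field_differentiable (at x)" if "x \<in> U" for k x
  proof -
    obtain g where g: "\<forall>x\<in>U. (deriv ^^ k) f x = g x" "diff_times 1 U g"
      using ex[OF f, of k 1] by blast
    then obtain g' where g': "\<forall>x\<in>U. (g has_real_derivative g' x) (at x)" by auto
    have "((deriv ^^ k) f has_real_derivative g' x) (at x)"
      by (rule has_field_derivative_transform_within_open[of g _ x U]) (use g g' that \<open>open U\<close> in simp_all)
    then show ?thesis by (auto simp: field_differentiable_def)
  qed
  with \<open>open U\<close> show ?thesis by (simp add: smooth_on_open_def)
qed

text \<open>Bootstrap: if both functions have order \<open>k\<close>, so do the right-hand sides,
  which gives order \<open>k + 1\<close>. Each function needs the other, hence the simultaneous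
  induction.\<close>

lemma diff_times_linear_pair:
  assumes "\<And>x. x \<in> U \<Longrightarrow> (p has_real_derivative A x * q x) (at x)"
    and "\<And>x. x \<in> U \<Longrightarrow> (q has_real_derivative B x * p x) (at x)"
    and "\<And>k. diff_times k U A" "\<And>k. diff_times k U B"
  shows "diff_times k U p" "diff_times k U q"
proof (induction k)
  case (Suc k)
  case 1 show ?case by (rule diff_times_SucI[OF assms(1)]) (auto intro: diff_times_mult assms Suc)
next
  case (Suc k)
  case 2 show ?case by (rule diff_times_SucI[OF assms(2)]) (auto intro: diff_times_mult assms Suc)
qed simp_all

section \<open>A linear system with nonnegative coefficients\<close>

text \<open>A signed integral, because the mode has to be smooth across the inner edge
  \<open>a\<close> of the support and the system is therefore solved on both sides of its initial
  point.\<close>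

definition primitive_from :: "real \<Rightarrow> (real \<Rightarrow> real) \<Rightarrow> real \<Rightarrow> real" where
  "primitive_from t f x = (if t \<le> x then integral {t..x} f else - integral {x..t} f)"

lemma primitive_from_self [simp]: "primitive_from t f t = 0"
  by (simp add: primitive_from_def)

lemma primitive_from_has_derivative:
  assumes "continuous_on {c<..<d} f" "t \<in> {c<..<d}" "x \<in> {c<..<d}"
  shows "(primitive_from t f has_real_derivative f x) (at x)"
proof -
  obtain c' where c': "c < c'" "c' < t" "c' < x" using assms dense[of c "min t x"] by auto
  obtain d' where d': "d' < d" "t < d'" "x < d'" using assms dense[of "max t x" d] by auto
  have cont: "continuous_on {c'..d'} f"
    by (rule continuous_on_subset[OF assms(1)]) (use c' d' in auto)
  then have int: "f integrable_on {u..v}" if "c' \<le> u" "v \<le> d'" for u v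
    using that by (intro integrable_continuous_interval) (auto elim: continuous_on_subset)
  have eq: "primitive_from t f z = integral {c'..z} f - integral {c'..t} f" if "z \<in> {c'..d'}" for z
  proof (cases "t \<le> z")
    case True
    then show ?thesis
      using Henstock_Kurzweil_Integration.integral_combine[of c' t z f] int[of c' z] c' that
      by (simp add: primitive_from_def)
  next
    case False
    then show ?thesis
      using Henstock_Kurzweil_Integration.integral_combine[of c' z t f] int[of c' t] c' d' that
      by (simp add: primitive_from_def)
  qed
  have "((\<lambda>z. integral {c'..z} f) has_real_derivative f x) (at x within {c'..d'})"
    by (rule integral_has_real_derivative[OF cont]) (use c' d' in auto)
  then have "((\<lambda>z. integral {c'..z} f - integral {c'..t} f) has_real_derivative f x) (at x)"
    using c' d' by (auto simp: at_within_Icc_at intro!: derivative_eq_intros)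
  moreover have "\<forall>\<^sub>F z in nhds x. primitive_from t f z = integral {c'..z} f - integral {c'..t} f"
    using eventually_nhds_in_open[of "{c'<..<d'}" x] c' d' by (auto elim!: eventually_mono intro: eq)
  ultimately show ?thesis
    by (subst has_field_derivative_cong_ev) auto
qed

text \<open>One integration raises the exponent and the factorial by one, which is the induction
  step for the convergence of the Picard series. Left of \<open>t\<close> the comparison function is
  reflected.\<close>

lemma primitive_bound:
  fixes P f :: "real \<Rightarrow> real"
  assumes der: "\<And>x. x \<in> {c..d} \<Longrightarrow> (P has_real_derivative f x) (at x)"
    and f: "\<And>x. x \<in> {c..d} \<Longrightarrow> \<bar>f x\<bar> \<le> C * \<bar>x - t\<bar> ^ j / fact j"
    and "P t = 0" "t \<in> {c..d}" "x \<in> {c..d}"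
  shows "\<bar>P x\<bar> \<le> C * \<bar>x - t\<bar> ^ Suc j / fact (Suc j)"
proof -
  have cont: "continuous_on S P" if "S \<subseteq> {c..d}" for S
    using der that by (meson DERIV_isCont continuous_at_imp_continuous_on subsetD)
  have dv: "(P has_vector_derivative f s) (at s)" if "s \<in> {c..d}" for s
    using der[OF that] by (simp add: has_real_derivative_iff_has_vector_derivative)
  consider "x = t" | "t < x" | "x < t" by linarith
  then show ?thesis
  proof cases
    case 2
    have "norm (P x - P t) \<le> C * (x - t) ^ Suc j / fact (Suc j) - C * (t - t) ^ Suc j / fact (Suc j)"
    proof (rule differentiable_bound_general[OF 2])
      fix s assume s: "t < s" "s < x"
      then have "s \<in> {c..d}" using assms by auto
      with dv show "(P has_vector_derivative f s) (at s)" by blast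
      show "norm (f s) \<le> C * (s - t) ^ j / fact j" using f[OF \<open>s \<in> {c..d}\<close>] s by auto
      show "((\<lambda>s. C * (s - t) ^ Suc j / fact (Suc j)) has_vector_derivative C * (s - t) ^ j / fact j) (at s)"
        unfolding has_real_derivative_iff_has_vector_derivative[symmetric]
        by (rule derivative_eq_intros refl | simp)+
    qed (use assms in \<open>auto intro!: cont continuous_intros\<close>)
    with 2 assms show ?thesis by auto
  next
    case 3
    have "norm (P t - P x) \<le> - (C * (t - t) ^ Suc j / fact (Suc j)) - (- (C * (t - x) ^ Suc j / fact (Suc j)))"
    proof (rule differentiable_bound_general[OF 3])
      fix s assume s: "x < s" "s < t"
      then have "s \<in> {c..d}" using assms by auto
      with dv show "(P has_vector_derivative f s) (at s)" by blast
      show "norm (f s) \<le> C * (t - s) ^ j / fact j" using f[OF \<open>s \<in> {c..d}\<close>] s by auto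
      show "((\<lambda>s. - (C * (t - s) ^ Suc j / fact (Suc j))) has_vector_derivative C * (t - s) ^ j / fact j) (at s)"
        unfolding has_real_derivative_iff_has_vector_derivative[symmetric]
        by (rule derivative_eq_intros refl | simp)+
    qed (use assms in \<open>auto intro!: cont continuous_intros\<close>)
    with 3 assms show ?thesis by auto
  qed (use assms in simp)
qed

text \<open>The Picard series converges on the whole open interval because it does so uniformly on
  compact parts; the coefficients may blow up at the ends, as the one with \<open>(F r)^2\<close> in
  the denominator does at \<open>R0\<close>. Right of \<open>t\<close> every term is nonnegative, so
  the solution stays above its initial values.\<close>

lemma linear_pair_solution:
  fixes A B :: "real \<Rightarrow> real"
  assumes A: "continuous_on {c<..<d} A" "\<And>x. x \<in> {c<..<d} \<Longrightarrow> 0 \<le> A x"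
    and B: "continuous_on {c<..<d} B" "\<And>x. x \<in> {c<..<d} \<Longrightarrow> 0 \<le> B x"
    and t: "t \<in> {c<..<d}" and init: "0 \<le> p0" "0 \<le> q0"
  obtains p q where "p t = p0" "q t = q0"
    and "\<And>x. x \<in> {c<..<d} \<Longrightarrow> (p has_real_derivative A x * q x) (at x)"
    and "\<And>x. x \<in> {c<..<d} \<Longrightarrow> (q has_real_derivative B x * p x) (at x)"
    and "\<And>x. x \<in> {t..<d} \<Longrightarrow> p0 \<le> p x" "\<And>x. x \<in> {t..<d} \<Longrightarrow> q0 \<le> q x"
proof -
  \<comment> \<open>The pairs \<open>u j\<close>, \<open>v j\<close> are differences of successive
    Picard iterates, not the iterates themselves: the solution is their sum, and each is obtained
    from the previous one by integration.\<close>
  define step where "step = (\<lambda>(u, v). (primitive_from t (\<lambda>s. A s * v s), primitive_from t (\<lambda>s. B s * u s)))"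
  define w where "w j = (step ^^ j) ((\<lambda>_. p0), (\<lambda>_. q0))" for j
  define u where "u j = fst (w j)" for j
  define v where "v j = snd (w j)" for j
  have u_0: "u 0 = (\<lambda>_. p0)" and v_0: "v 0 = (\<lambda>_. q0)"
    by (simp_all add: u_def v_def w_def)
  have u_Suc: "u (Suc j) = primitive_from t (\<lambda>s. A s * v j s)"
    and v_Suc: "v (Suc j) = primitive_from t (\<lambda>s. B s * u j s)" for j
    by (simp_all add: u_def v_def w_def step_def case_prod_unfold)
  have cont: "continuous_on {c<..<d} (u j) \<and> continuous_on {c<..<d} (v j)" for j
  proof (induction j)
    case 0
    then show ?case by (simp add: u_0 v_0)
  next
    case (Suc j)
    have "continuous_on {c<..<d} (primitive_from t f)" if "continuous_on {c<..<d} f" for f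
      using primitive_from_has_derivative[OF that t]
      by (meson DERIV_isCont continuous_at_imp_continuous_on)
    then show ?case unfolding u_Suc v_Suc using Suc A B by (auto intro: continuous_on_mult)
  qed
  have u_der: "(u (Suc j) has_real_derivative A x * v j x) (at x)"
    and v_der: "(v (Suc j) has_real_derivative B x * u j x) (at x)" if "x \<in> {c<..<d}" for j x
    unfolding u_Suc v_Suc
    using primitive_from_has_derivative[OF continuous_on_mult[OF A(1) conjunct2[OF cont]] t that]
      primitive_from_has_derivative[OF continuous_on_mult[OF B(1) conjunct1[OF cont]] t that]
    by blast+
  have nonneg: "0 \<le> u j x \<and> 0 \<le> v j x" if "x \<in> {t..<d}" for j x
    using that
  proof (induction j arbitrary: x)
    case 0
    then show ?case by (simp add: u_0 v_0 init)
  next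
    case (Suc j)
    have sub: "s \<in> {c<..<d}" "s \<in> {t..<d}" if "s \<in> {t..x}" for s
      using that Suc.prems t by auto
    have "continuous_on {t..x} (\<lambda>s. A s * v j s)" "continuous_on {t..x} (\<lambda>s. B s * u j s)"
      using A(1) B(1) cont[of j] sub
      by (auto intro!: continuous_on_mult elim!: continuous_on_subset)
    then have "0 \<le> integral {t..x} (\<lambda>s. A s * v j s)" "0 \<le> integral {t..x} (\<lambda>s. B s * u j s)"
      using A(2) B(2) Suc.IH sub
      by (auto intro!: Henstock_Kurzweil_Integration.integral_nonneg integrable_continuous_interval mult_nonneg_nonneg)
    then show ?case
      unfolding u_Suc v_Suc primitive_from_def using Suc.prems by simp
  qed
  define p where "p x = (\<Sum>j. u j x)" for x
  define q where "q x = (\<Sum>j. v j x)" for x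
  have local: "summable (\<lambda>j. u j x) \<and> summable (\<lambda>j. v j x)
      \<and> (p has_real_derivative A x * q x) (at x) \<and> (q has_real_derivative B x * p x) (at x)"
    if x: "x \<in> {c<..<d}" for x
  proof -
    \<comment> \<open>A compact interval around both \<open>x\<close> and \<open>t\<close>. There
      the coefficients are bounded by some \<open>M\<close>, and the terms are dominated by an
      exponential series.\<close>
    obtain c' where c': "c < c'" "c' < t" "c' < x" using x t dense[of c "min t x"] by auto
    obtain d' where d': "d' < d" "t < d'" "x < d'" using x t dense[of "max t x" d] by auto
    have sub: "{c'..d'} \<subseteq> {c<..<d}" using c' d' by auto
    have "compact (A ` {c'..d'} \<union> B ` {c'..d'})"
      using A B sub by (intro compact_Un compact_continuous_image) (auto elim: continuous_on_subset)
    then obtain M where M: "\<forall>y\<in>A ` {c'..d'} \<union> B ` {c'..d'}. norm y \<le> M"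
      using compact_imp_bounded bounded_iff by blast
    then have M': "\<bar>A s\<bar> \<le> M" "\<bar>B s\<bar> \<le> M" if "s \<in> {c'..d'}" for s
      using that by auto
    have "0 \<le> M" using M'(1)[of t] c' d' by auto
    define K where "K = max p0 q0"
    have K: "p0 \<le> K" "q0 \<le> K" "0 \<le> K" using init by (auto simp: K_def)
    have bd: "\<bar>u j s\<bar> \<le> K * M ^ j * \<bar>s - t\<bar> ^ j / fact j \<and> \<bar>v j s\<bar> \<le> K * M ^ j * \<bar>s - t\<bar> ^ j / fact j"
      if "s \<in> {c'..d'}" for j s
      using that
    proof (induction j arbitrary: s)
      case 0
      then show ?case using K init by (simp add: u_0 v_0)
    next
      case (Suc j)
      have A_le: "\<bar>A y * v j y\<bar> \<le> K * M ^ Suc j * \<bar>y - t\<bar> ^ j / fact j"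
        and B_le: "\<bar>B y * u j y\<bar> \<le> K * M ^ Suc j * \<bar>y - t\<bar> ^ j / fact j" if "y \<in> {c'..d'}" for y
        using mult_mono[OF M'(1)[OF that] conjunct2[OF Suc.IH[OF that]] \<open>0 \<le> M\<close>]
          mult_mono[OF M'(2)[OF that] conjunct1[OF Suc.IH[OF that]] \<open>0 \<le> M\<close>]
        by (simp_all add: abs_mult mult_ac)
      have "\<bar>u (Suc j) s\<bar> \<le> K * M ^ Suc j * \<bar>s - t\<bar> ^ Suc j / fact (Suc j)"
        by (rule primitive_bound[where c = c' and d = d', OF u_der A_le])
          (use Suc.prems sub c' d' in \<open>auto simp: u_Suc\<close>)
      moreover have "\<bar>v (Suc j) s\<bar> \<le> K * M ^ Suc j * \<bar>s - t\<bar> ^ Suc j / fact (Suc j)"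
        by (rule primitive_bound[where c = c' and d = d', OF v_der B_le])
          (use Suc.prems sub c' d' in \<open>auto simp: v_Suc\<close>)
      ultimately show ?case by blast
    qed
    define L where "L = M * (d' - c')"
    have "0 \<le> L" using \<open>0 \<le> M\<close> c' d' by (simp add: L_def)
    have bd': "\<bar>u j s\<bar> \<le> K * (L ^ j / fact j) \<and> \<bar>v j s\<bar> \<le> K * (L ^ j / fact j)" if "s \<in> {c'..d'}" for j s
    proof -
      have "\<bar>s - t\<bar> \<le> d' - c'" using that c' d' by auto
      then have "M ^ j * \<bar>s - t\<bar> ^ j \<le> L ^ j"
        unfolding L_def power_mult_distrib using \<open>0 \<le> M\<close> by (intro mult_left_mono power_mono) auto
      then have "K * M ^ j * \<bar>s - t\<bar> ^ j / fact j \<le> K * (L ^ j / fact j)"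
        using K by (simp add: divide_right_mono mult_left_mono mult.assoc)
      with bd[OF that, of j] show ?thesis by linarith
    qed
    have exp_summable: "summable (\<lambda>j. K * (L ^ j / fact j))"
      using summable_exp[of L] by (auto intro!: summable_mult simp: divide_inverse mult.commute)
    have sum_u: "summable (\<lambda>j. u j s)" and sum_v: "summable (\<lambda>j. v j s)" if "s \<in> {c'..d'}" for s
      using bd' that by (auto intro: summable_comparison_test'[OF exp_summable])
    \<comment> \<open>Differentiating term \<open>Suc i\<close> gives term \<open>i\<close> of the
      other series times a coefficient, so the index shifts by one; the constant term contributes
      0.\<close>
    define du where "du j s = (case j of 0 \<Rightarrow> 0 | Suc i \<Rightarrow> A s * v i s)" for j s
    define dv where "dv j s = (case j of 0 \<Rightarrow> 0 | Suc i \<Rightarrow> B s * u i s)" for j s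
    have dbd: "\<bar>A s * v i s\<bar> \<le> M * (K * L ^ i / fact i)" "\<bar>B s * u i s\<bar> \<le> M * (K * L ^ i / fact i)"
      if "s \<in> {c'..d'}" for i s
      using mult_mono[OF M'(1)[OF that] conjunct2[OF bd'[OF that]] \<open>0 \<le> M\<close>]
        mult_mono[OF M'(2)[OF that] conjunct1[OF bd'[OF that]] \<open>0 \<le> M\<close>]
      by (simp_all add: abs_mult)
    have majorant: "summable (\<lambda>j. case j of 0 \<Rightarrow> 0 | Suc i \<Rightarrow> M * (K * L ^ i / fact i))"
      by (subst summable_Suc_iff[symmetric]) (use summable_mult[OF exp_summable, of M] in simp)
    have unif_u: "uniformly_convergent_on {c'..d'} (\<lambda>k s. \<Sum>i<k. du i s)"
      by (rule Weierstrass_m_test'[OF _ majorant]) (use dbd in \<open>auto simp: du_def split: nat.split\<close>)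
    have unif_v: "uniformly_convergent_on {c'..d'} (\<lambda>k s. \<Sum>i<k. dv i s)"
      by (rule Weierstrass_m_test'[OF _ majorant]) (use dbd in \<open>auto simp: dv_def split: nat.split\<close>)
    have inner: "x \<in> interior {c'..d'}" "t \<in> {c'..d'}" "x \<in> {c'..d'}" using c' d' by auto
    have du: "(u j has_field_derivative du j s) (at s within {c'..d'})"
      and dv: "(v j has_field_derivative dv j s) (at s within {c'..d'})" if "s \<in> {c'..d'}" for j s
      using that sub by (auto simp: du_def dv_def u_0 v_0 split: nat.split
          intro!: DERIV_subset[OF u_der] DERIV_subset[OF v_der])
    have "(p has_real_derivative (\<Sum>j. du j x)) (at x)"
      unfolding p_def
      by (rule has_field_derivative_series'(2)[OF _ du unif_u inner(2) sum_u inner(1)]) (use inner in auto)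
    moreover have "(\<Sum>j. du j x) = A x * q x"
    proof -
      have "(\<lambda>j. du (Suc j) x) sums (A x * q x)"
        using sum_v[OF inner(3)] by (auto simp: du_def q_def intro!: sums_mult summable_sums)
      then show ?thesis by (subst (asm) sums_Suc_iff) (simp add: du_def sums_iff)
    qed
    moreover have "(q has_real_derivative (\<Sum>j. dv j x)) (at x)"
      unfolding q_def
      by (rule has_field_derivative_series'(2)[OF _ dv unif_v inner(2) sum_v inner(1)]) (use inner in auto)
    moreover have "(\<Sum>j. dv j x) = B x * p x"
    proof -
      have "(\<lambda>j. dv (Suc j) x) sums (B x * p x)"
        using sum_u[OF inner(3)] by (auto simp: dv_def p_def intro!: sums_mult summable_sums)
      then show ?thesis by (subst (asm) sums_Suc_iff) (simp add: dv_def sums_iff)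
    qed
    ultimately show ?thesis using sum_u sum_v inner(3) by auto
  qed
  have "p t = p0"
    unfolding p_def by (subst suminf_finite[of "{0}"]) (auto simp: u_0 u_Suc gr0_conv_Suc)
  moreover have "q t = q0"
    unfolding q_def by (subst suminf_finite[of "{0}"]) (auto simp: v_0 v_Suc gr0_conv_Suc)
  moreover have "p0 \<le> p x" "q0 \<le> q x" if "x \<in> {t..<d}" for x
  proof -
    have x: "x \<in> {c<..<d}" using that t by auto
    show "p0 \<le> p x"
      using sum_le_suminf[of "\<lambda>j. u j x" "{0}"] local[OF x] nonneg[OF that] by (simp add: p_def u_0)
    show "q0 \<le> q x"
      using sum_le_suminf[of "\<lambda>j. v j x" "{0}"] local[OF x] nonneg[OF that] by (simp add: q_def v_0)
  qed
  ultimately show ?thesis using local that by blast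
qed

section \<open>The Rayleigh equation\<close>

text \<open>
  Up to normalization the two moments below are \<open>r^-n (n \<psi> + r \<psi>')\<close> and \<open>r^n (n \<psi> - r \<psi>')\<close> for
  \<open>\<psi> = r F h\<close>: the coefficients of \<open>r^n\<close> and \<open>r^-n\<close> in \<open>\<psi>\<close>, which change only through the vorticity
  gradient \<open>g\<close>.
\<close>

context
  fixes n :: nat and F F' g h y :: "real \<Rightarrow> real" and r :: real
  assumes r: "0 < r" "F r > 0" and n: "n \<ge> 1"
    and F: "(F has_real_derivative F' r) (at r)"
    and F': "(F' has_real_derivative (g r - 3 * F' r) / r) (at r)"
    and h: "(h has_real_derivative 1 / (r ^ 3 * (F r)\<^sup>2) * y r) (at r)"
    and y: "(y has_real_derivative ((real n)\<^sup>2 - 1) * r * (F r)\<^sup>2 * h r) (at r)"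
begin

private lemma stream_derivative:
  "((\<lambda>r. r * F r * h r) has_real_derivative
     (r * F r * h r + r\<^sup>2 * F' r * h r + y r / (r * F r)) / r) (at r)"
  using r by (auto intro!: derivative_eq_intros F h simp: field_simps power2_eq_square power3_eq_cube)

text \<open>Since \<open>y\<close> stands for r^3 F^2 h', the differentiated function is r \<psi>'
  for \<psi> = r F h. All terms with \<open>y\<close> cancel, and Rayleigh's equation (r \<psi>')' =
  n^2 \<psi> / r + g \<psi> / F remains.\<close>

private lemma flux_derivative:
  "((\<lambda>r. r * F r * h r + r\<^sup>2 * F' r * h r + y r / (r * F r)) has_real_derivative
     (real n)\<^sup>2 * F r * h r + r * g r * h r) (at r)"
  using r by (auto intro!: derivative_eq_intros F F' h y simp: field_simps power2_eq_square power3_eq_cube)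

private lemma power_derivative: "((\<lambda>r. r ^ n) has_real_derivative n * r ^ n / r) (at r)"
proof -
  have "n * r ^ n / r = n * r ^ (n - Suc 0)"
    using r n by (cases n) auto
  then show ?thesis using DERIV_pow[of n r] by simp
qed

lemma outer_moment_derivative:
  "((\<lambda>r. (n * (r * F r * h r) + (r * F r * h r + r\<^sup>2 * F' r * h r + y r / (r * F r))) / (2 * n * r ^ n))
     has_real_derivative r * g r * h r / r ^ n / (2 * n)) (at r)"
proof -
  have "((\<lambda>r. (n * (r * F r * h r) + (r * F r * h r + r\<^sup>2 * F' r * h r + y r / (r * F r))) / (2 * n * r ^ n))
    has_real_derivative
     ((n * ((r * F r * h r + r\<^sup>2 * F' r * h r + y r / (r * F r)) / r) + ((real n)\<^sup>2 * F r * h r + r * g r * h r)) * (2 * n * r ^ n)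
      - (n * (r * F r * h r) + (r * F r * h r + r\<^sup>2 * F' r * h r + y r / (r * F r))) * (2 * n * (n * r ^ n / r)))
     / ((2 * n * r ^ n) * (2 * n * r ^ n))) (at r)"
    using r n by (intro DERIV_divide DERIV_add DERIV_cmult stream_derivative flux_derivative power_derivative) auto
  also have "((n * ((r * F r * h r + r\<^sup>2 * F' r * h r + y r / (r * F r)) / r) + ((real n)\<^sup>2 * F r * h r + r * g r * h r)) * (2 * n * r ^ n)
      - (n * (r * F r * h r) + (r * F r * h r + r\<^sup>2 * F' r * h r + y r / (r * F r))) * (2 * n * (n * r ^ n / r)))
     / ((2 * n * r ^ n) * (2 * n * r ^ n)) = r * g r * h r / r ^ n / (2 * n)"
  proof -
    define z where "z = y r / (r * F r)"
    define w where "w = r ^ n"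
    have "w \<noteq> 0" using r by (simp add: w_def)
    then show ?thesis using r n unfolding z_def[symmetric] w_def[symmetric]
      by (simp add: field_simps power2_eq_square)
  qed
  finally show ?thesis .
qed

lemma inner_moment_derivative:
  "((\<lambda>r. r ^ n * (n * (r * F r * h r) - (r * F r * h r + r\<^sup>2 * F' r * h r + y r / (r * F r))) / (2 * n))
     has_real_derivative - (r ^ (n + 1) * g r * h r / (2 * n))) (at r)"
proof -
  have "((\<lambda>r. r ^ n * (n * (r * F r * h r) - (r * F r * h r + r\<^sup>2 * F' r * h r + y r / (r * F r))) / (2 * n))
    has_real_derivative
     ((n * r ^ n / r) * (n * (r * F r * h r) - (r * F r * h r + r\<^sup>2 * F' r * h r + y r / (r * F r)))
      + (n * ((r * F r * h r + r\<^sup>2 * F' r * h r + y r / (r * F r)) / r) - ((real n)\<^sup>2 * F r * h r + r * g r * h r)) * r ^ n)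
     / (2 * n)) (at r)"
    by (intro DERIV_cdivide DERIV_mult DERIV_diff DERIV_cmult stream_derivative flux_derivative power_derivative)
  also have "((n * r ^ n / r) * (n * (r * F r * h r) - (r * F r * h r + r\<^sup>2 * F' r * h r + y r / (r * F r)))
      + (n * ((r * F r * h r + r\<^sup>2 * F' r * h r + y r / (r * F r)) / r) - ((real n)\<^sup>2 * F r * h r + r * g r * h r)) * r ^ n)
     / (2 * n) = - (r ^ (n + 1) * g r * h r / (2 * n))"
  proof -
    define z where "z = y r / (r * F r)"
    define w where "w = r ^ n"
    have "r ^ (n + 1) = r * w" by (simp add: w_def)
    then show ?thesis using r n unfolding z_def[symmetric] w_def[symmetric]
      by (simp add: field_simps power2_eq_square)
  qed
  finally show ?thesis .
qed

text \<open>The derivative of r^n \<psi> has the sign of n \<psi> + r \<psi>', so this product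
  cannot decrease while the outer moment is nonnegative.\<close>

lemma weighted_stream_derivative:
  "((\<lambda>r. r ^ n * (r * F r * h r)) has_real_derivative
     r ^ n * (n * (r * F r * h r) + (r * F r * h r + r\<^sup>2 * F' r * h r + y r / (r * F r))) / r) (at r)"
proof -
  have "((\<lambda>r. r ^ n * (r * F r * h r)) has_real_derivative
     (n * r ^ n / r) * (r * F r * h r)
      + (r * F r * h r + r\<^sup>2 * F' r * h r + y r / (r * F r)) / r * r ^ n) (at r)"
    by (intro DERIV_mult stream_derivative power_derivative)
  also have "(n * r ^ n / r) * (r * F r * h r)
      + (r * F r * h r + r\<^sup>2 * F' r * h r + y r / (r * F r)) / r * r ^ n
      = r ^ n * (n * (r * F r * h r) + (r * F r * h r + r\<^sup>2 * F' r * h r + y r / (r * F r))) / r"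
    by (simp only: add_divide_distrib distrib_left distrib_right times_divide_eq_right times_divide_eq_left mult_ac)
  finally show ?thesis .
qed

end

section \<open>The background vorticity and its angular velocity\<close>

definition vort :: "real \<Rightarrow> real" where
  "vort r = 1 / (1 + r\<^sup>2)"

definition vort' :: "real \<Rightarrow> real" where
  "vort' r = - 2 * r / (1 + r\<^sup>2)\<^sup>2"

text \<open>Angular velocity \<open>(\<integral> s \<omega>(s) ds over [0, r]) / r\<^sup>2\<close> of the profile \<open>\<omega>\<close> that equals \<open>vort a\<close> on \<open>[0, a]\<close> and \<open>vort\<close> beyond.\<close>

definition angvel :: "real \<Rightarrow> real \<Rightarrow> real" where
  "angvel a r = (ln (1 + r\<^sup>2) + a\<^sup>2 / (1 + a\<^sup>2) - ln (1 + a\<^sup>2)) / (2 * r\<^sup>2)"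

text \<open>This encodes the relation \<omega> = 2 \<Omega> + r \<Omega>' between vorticity and
  angular velocity of a radial flow.\<close>

definition angvel' :: "real \<Rightarrow> real \<Rightarrow> real" where
  "angvel' a r = (vort r - 2 * angvel a r) / r"

lemma one_plus_square_pos [simp]: "0 < 1 + (r::real)\<^sup>2"
  by (simp add: add_pos_nonneg)

lemma one_plus_square_neq_0 [simp]: "1 + (r::real)\<^sup>2 \<noteq> 0"
  using one_plus_square_pos[of r] by linarith

lemma vort_has_derivative: "(vort has_real_derivative vort' r) (at r)"
  unfolding vort_def vort'_def
  by (rule derivative_eq_intros refl | simp)+ (simp add: power2_eq_square)

lemma vort'_neg: "0 < r \<Longrightarrow> vort' r < 0"
  by (simp add: vort'_def divide_neg_pos)

lemma angvel_has_derivative: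
  assumes "0 < r"
  shows "(angvel a has_real_derivative angvel' a r) (at r)"
proof -
  define C where "C = a\<^sup>2 / (1 + a\<^sup>2) - ln (1 + a\<^sup>2)"
  define N where "N r = ln (1 + r\<^sup>2) + C" for r
  have angvel: "angvel a r = N r / (2 * r\<^sup>2)" for r
    by (simp add: angvel_def N_def C_def)
  have "(N has_real_derivative 2 * r * vort r) (at r)"
    unfolding N_def vort_def by (rule derivative_eq_intros refl one_plus_square_pos | simp)+
  then have "((\<lambda>r. N r / (2 * r\<^sup>2)) has_real_derivative
      (2 * r * vort r * (2 * r\<^sup>2) - N r * (4 * r)) / (2 * r\<^sup>2 * (2 * r\<^sup>2))) (at r)"
    using assms by (intro DERIV_divide) (auto intro!: derivative_eq_intros)
  also have "(2 * r * vort r * (2 * r\<^sup>2) - N r * (4 * r)) / (2 * r\<^sup>2 * (2 * r\<^sup>2)) = angvel' a r"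
    using assms by (simp add: angvel'_def angvel field_simps power2_eq_square)
  finally show ?thesis by (simp add: angvel[abs_def])
qed

lemma angvel'_has_derivative:
  assumes "0 < r"
  shows "(angvel' a has_real_derivative (vort' r - 3 * angvel' a r) / r) (at r)"
proof -
  have "((\<lambda>r. (vort r - 2 * angvel a r) / r) has_real_derivative
      ((vort' r - 2 * angvel' a r) * r - (vort r - 2 * angvel a r) * 1) / (r * r)) (at r)"
    using assms by (intro DERIV_divide DERIV_diff DERIV_cmult DERIV_ident vort_has_derivative angvel_has_derivative) auto
  moreover have "((vort' r - 2 * angvel' a r) * r - (vort r - 2 * angvel a r) * 1) / (r * r)
      = (vort' r - 3 * angvel' a r) / r"
    using assms by (simp add: angvel'_def field_simps)
  ultimately show ?thesis by (simp add: angvel'_def[abs_def])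
qed

lemma angvel'_self: "0 < a \<Longrightarrow> angvel' a a = 0"
proof -
  assume "0 < a"
  moreover have "2 + a\<^sup>2 * 2 \<noteq> 0" using one_plus_square_neq_0[of a] by argo
  ultimately show ?thesis by (simp add: angvel'_def angvel_def vort_def frac_eq_eq)
qed

text \<open>The function is r^3 \<open>angvel' a r\<close>. It vanishes at \<open>a\<close>, so its
  monotonicity gives the sign of \<open>angvel'\<close>; it also serves as the primitive for the
  inner integral in \<open>c_coeff\<close>.\<close>

lemma vort_deficit_has_derivative:
  assumes "0 < r"
  shows "((\<lambda>r. r\<^sup>2 * (vort r - 2 * angvel a r)) has_real_derivative r\<^sup>2 * vort' r) (at r)"
proof -
  have "((\<lambda>r. r\<^sup>2 * (vort r - 2 * angvel a r)) has_real_derivative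
     2 * r * (vort r - 2 * angvel a r) + (vort' r - 2 * angvel' a r) * r\<^sup>2) (at r)"
    by (auto intro!: derivative_eq_intros vort_has_derivative angvel_has_derivative assms)
  also have "2 * r * (vort r - 2 * angvel a r) + (vort' r - 2 * angvel' a r) * r\<^sup>2 = r\<^sup>2 * vort' r"
    using assms by (simp add: angvel'_def power2_eq_square field_simps)
  finally show ?thesis .
qed

lemma angvel'_neg:
  assumes "0 < a" "a < r"
  shows "angvel' a r < 0"
proof -
  have "r\<^sup>2 * (vort r - 2 * angvel a r) < a\<^sup>2 * (vort a - 2 * angvel a a)"
    by (rule DERIV_neg_imp_decreasing[OF assms(2)])
      (use assms in \<open>auto intro!: exI vort_deficit_has_derivative mult_pos_neg vort'_neg\<close>)
  then have "r\<^sup>2 * (vort r - 2 * angvel a r) < 0"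
    using angvel'_self[OF assms(1)] assms by (simp add: angvel'_def)
  then have "vort r - 2 * angvel a r < 0"
    by (simp add: mult_less_0_iff)
  then show ?thesis
    using assms by (simp add: angvel'_def divide_neg_pos)
qed

lemma angvel_strict_decreasing:
  assumes "0 < a" "a \<le> r" "r < s"
  shows "angvel a s < angvel a r"
proof (rule DERIV_neg_imp_decreasing_open[OF assms(3)])
  show "continuous_on {r..s} (angvel a)"
    using assms by (intro continuous_at_imp_continuous_on ballI DERIV_isCont[OF angvel_has_derivative]) auto
qed (use assms in \<open>auto intro!: exI angvel_has_derivative angvel'_neg\<close>)

lemma angvel_tendsto_0: "(angvel a \<longlongrightarrow> 0) at_top"
  unfolding angvel_def by real_asymp


text \<open>The final identity is the integral equation times 2 n r, with the kernel split at s = r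
  and the constant part of \<open>c_coeff\<close> absorbed into \<open>lam\<close>. The outer edge
  \<open>R\<close> comes out of the construction; only the lower bound \<open>R1\<close> is
  prescribed.\<close>

lemma neutral_mode_exists:
  fixes n :: nat
  assumes n: "n \<ge> 1" and a: "0 < a" "a < R1"
  obtains lam R h U where "R1 < R" "open U" "{a..R} \<subseteq> U" "smooth_on_open U h"
    and "\<And>r. r \<in> {a..R} \<Longrightarrow> 0 < h r"
    and "\<And>r. r \<in> {a..R} \<Longrightarrow> 2 * n * (r * (angvel a r - lam) * h r) =
      - (integral {a..r} (\<lambda>s. s ^ (n + 1) * vort' s * h s) / r ^ n
         + r ^ n * integral {r..R} (\<lambda>s. s * vort' s * h s / s ^ n))"
proof -
  \<comment> \<open>\<open>R0\<close> is taken so far out that 2 \<open>lam\<close> <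
    \<open>vort R1\<close>. This makes the outer moment positive at \<open>R1\<close> and pushes its
    zero beyond \<open>R1\<close>.\<close>
  have "\<forall>\<^sub>F r in at_top. 2 * angvel a r < vort R1"
  proof -
    have "((\<lambda>r. 2 * angvel a r) \<longlongrightarrow> 2 * 0) at_top"
      by (intro tendsto_intros angvel_tendsto_0)
    then show ?thesis by (rule order_tendstoD) (simp add: vort_def)
  qed
  then have "\<forall>\<^sub>F r in at_top. 2 * angvel a r < vort R1 \<and> R1 < r"
    by (intro eventually_conj eventually_gt_at_top)
  then obtain R0 where R0: "2 * angvel a R0 < vort R1" "R1 < R0"
    by (auto simp: eventually_at_top_linorder)
  define lam where "lam = angvel a R0"
  define F where "F r = angvel a r - lam" for r :: real
  have F_der: "(F has_real_derivative angvel' a r) (at r)" if "0 < r" for r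
    unfolding F_def[abs_def] using angvel_has_derivative[OF that, of a] by (auto intro!: derivative_eq_intros)
  have F_pos_right: "0 < F r" if "r \<in> {a..<R0}" for r
    using angvel_strict_decreasing[of a r R0] that a by (simp add: F_def lam_def)
  \<comment> \<open>Smoothness up to the boundary asks for an open neighbourhood of the support, so
    the system is also solved slightly left of \<open>a\<close>, where \<open>angvel a\<close> is
    merely the continuation of its formula.\<close>
  obtain c where c: "0 < c" "c < a" "\<And>r. r \<in> {c<..<R0} \<Longrightarrow> 0 < F r"
  proof -
    have "isCont F a" using F_der a DERIV_isCont by blast
    moreover have "0 < F a" using F_pos_right a R0 by simp
    ultimately have "\<forall>\<^sub>F r in nhds a. 0 < F r"
      using order_tendstoD(1)[of F "F a" "at a" 0]
      by (auto simp: isCont_def eventually_at_filter elim: eventually_mono)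
    then obtain d where d: "0 < d" "\<And>r. dist r a < d \<Longrightarrow> 0 < F r"
      by (auto simp: eventually_nhds_metric)
    show ?thesis
    proof (rule that[of "max (a / 2) (a - d)"])
      fix r assume r: "r \<in> {max (a / 2) (a - d)<..<R0}"
      show "0 < F r"
        by (cases "r < a") (use r d(2)[of r] F_pos_right[of r] in \<open>auto simp: dist_real_def\<close>)
    qed (use a d in auto)
  qed
  have cont_F: "continuous_on {c<..<R0} F"
    using c by (intro continuous_at_imp_continuous_on ballI DERIV_isCont[OF F_der]) auto
  define A where "A r = 1 / (r ^ 3 * (F r)\<^sup>2)" for r :: real
  define B where "B r = ((real n)\<^sup>2 - 1) * r * (F r)\<^sup>2" for r :: real
  have neq: "r \<noteq> 0" "F r \<noteq> 0" if "r \<in> {c<..<R0}" for r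
    using that c(1) c(3)[OF that] by auto
  \<comment> \<open>The value of \<open>y a\<close> expresses r \<psi>' = n \<psi> at
    \<open>a\<close>, where \<open>angvel'\<close> vanishes: then a F + y / (a F) = n a F for h =
    1.\<close>
  obtain h y where h_a: "h a = 1" and y_a: "y a = (n - 1) * a\<^sup>2 * (F a)\<^sup>2"
    and h_der: "\<And>r. r \<in> {c<..<R0} \<Longrightarrow> (h has_real_derivative A r * y r) (at r)"
    and y_der: "\<And>r. r \<in> {c<..<R0} \<Longrightarrow> (y has_real_derivative B r * h r) (at r)"
    and h_ge: "\<And>r. r \<in> {a..<R0} \<Longrightarrow> 1 \<le> h r"
    and y_ge: "\<And>r. r \<in> {a..<R0} \<Longrightarrow> (n - 1) * a\<^sup>2 * (F a)\<^sup>2 \<le> y r"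
  proof (rule linear_pair_solution[of c R0 A B a 1 "(n - 1) * a\<^sup>2 * (F a)\<^sup>2"])
    show "continuous_on {c<..<R0} A" unfolding A_def
      using neq by (intro continuous_intros cont_F) auto
    show "continuous_on {c<..<R0} B" unfolding B_def
      by (intro continuous_intros cont_F)
    show "0 \<le> A r" "0 \<le> B r" if "r \<in> {c<..<R0}" for r
      using that c n by (auto simp: A_def B_def intro!: mult_nonneg_nonneg)
  qed (use a R0 c n in auto)
  have F_k: "diff_times k {c<..<R0} F" for k
  proof -
    have ln: "diff_times k {c<..<R0} (\<lambda>r. ln (1 + r ^ 2))" for k
    proof (cases k)
      case (Suc j)
      show ?thesis unfolding Suc
      proof (rule diff_times_SucI[where f' = "\<lambda>r. 2 * r * inverse (1 + r ^ 2)"])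
        show "((\<lambda>r. ln (1 + r\<^sup>2)) has_real_derivative 2 * x * inverse (1 + x\<^sup>2)) (at x)" for x :: real
          by (rule derivative_eq_intros refl one_plus_square_pos | simp add: divide_inverse)+
      qed (auto intro!: diff_times_mult diff_times_inverse diff_times_add diff_times_const diff_times_ident diff_times_power)
    qed simp
    have F_eq: "F = (\<lambda>r. (ln (1 + r ^ 2) + (a\<^sup>2 / (1 + a\<^sup>2) - ln (1 + a\<^sup>2))) * inverse (2 * r ^ 2) + (- lam))"
      by (rule ext) (simp only: F_def angvel_def divide_inverse diff_conv_add_uminus add.assoc)
    show ?thesis unfolding F_eq
      by (intro diff_times_add diff_times_mult diff_times_inverse diff_times_const diff_times_power diff_times_ident ln)
        (use c in auto)
  qed
  have A_k: "diff_times k {c<..<R0} A" for k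
  proof -
    have A_eq: "A = (\<lambda>r. inverse (r ^ 3 * F r ^ 2))"
      by (simp add: A_def fun_eq_iff inverse_eq_divide)
    show ?thesis unfolding A_eq
      by (intro diff_times_mult diff_times_inverse diff_times_power diff_times_ident F_k) (use neq in auto)
  qed
  have B_k: "diff_times k {c<..<R0} B" for k
    unfolding B_def[abs_def] by (intro diff_times_mult diff_times_const diff_times_power diff_times_ident F_k)
  have smooth: "smooth_on_open {c<..<R0} h"
    by (intro smooth_on_openI diff_times_linear_pair(1)[OF h_der y_der A_k B_k]) auto

  \<comment> \<open>With \<psi> = r F h, \<open>flux\<close> is r \<psi>' and \<psi> =
    \<open>l r\<close> / r^n + r^n \<open>m r\<close>. The mode is regular at the origin if
    \<open>l\<close> vanishes at \<open>a\<close>, and decays outside if \<open>m\<close> vanishes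
    at the outer edge.\<close>
  define flux where "flux r = r * F r * h r + r\<^sup>2 * angvel' a r * h r + y r / (r * F r)" for r :: real
  define m where "m r = (n * (r * F r * h r) + flux r) / (2 * n * r ^ n)" for r :: real
  define l where "l r = r ^ n * (n * (r * F r * h r) - flux r) / (2 * n)" for r :: real
  have hyps: "0 < r" "0 < F r" "1 \<le> n" "(F has_real_derivative angvel' a r) (at r)"
    "(angvel' a has_real_derivative (vort' r - 3 * angvel' a r) / r) (at r)"
    "(h has_real_derivative 1 / (r ^ 3 * (F r)\<^sup>2) * y r) (at r)"
    "(y has_real_derivative ((real n)\<^sup>2 - 1) * r * (F r)\<^sup>2 * h r) (at r)"
    if "r \<in> {c<..<R0}" for r
    using that c n F_der[of r] angvel'_has_derivative[of r a] h_der[OF that] y_der[OF that]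
    by (auto simp: A_def B_def)
  have m_der: "(m has_real_derivative r * vort' r * h r / r ^ n / (2 * n)) (at r)" if "r \<in> {c<..<R0}" for r
    unfolding m_def[abs_def] flux_def by (rule outer_moment_derivative[where F = F and F' = "angvel' a" and g = vort' and h = h and y = y, OF hyps[OF that]])
  have l_der: "(l has_real_derivative - (r ^ (n + 1) * vort' r * h r / (2 * n))) (at r)" if "r \<in> {c<..<R0}" for r
    unfolding l_def[abs_def] flux_def by (rule inner_moment_derivative[where F = F and F' = "angvel' a" and g = vort' and h = h and y = y, OF hyps[OF that]])
  have psi_der: "((\<lambda>r. r ^ n * (r * F r * h r)) has_real_derivative 2 * n * (r ^ n * r ^ n) * m r / r) (at r)"
    if "r \<in> {c<..<R0}" for r :: real
  proof -
    have eq: "2 * n * (r ^ n * r ^ n) * m r / r = r ^ n * (n * (r * F r * h r) + flux r) / r"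
      using neq[OF that] n by (simp add: m_def)
    show ?thesis
      unfolding eq using weighted_stream_derivative[where F = F and F' = "angvel' a" and g = vort' and h = h and y = y, OF hyps[OF that]] by (simp add: flux_def)
  qed
  have l_a: "l a = 0"
  proof -
    have "y a / (a * F a) = (real n - 1) * (a * F a)"
      using y_a n neq[of a] a R0 c by (simp add: power2_eq_square of_nat_diff)
    then have "flux a = n * (a * F a * h a)"
      using angvel'_self[OF a(1)] h_a by (simp add: flux_def algebra_simps)
    then show ?thesis by (simp add: l_def)
  qed
  have F_R1: "0 < F R1" "1 \<le> h R1" "0 \<le> y R1"
    using F_pos_right[of R1] h_ge[of R1] order_trans[OF _ y_ge[of R1]] a R0 by auto
  \<comment> \<open>Since \<open>n\<close> is at least 1 and \<open>y\<close> is nonnegative, n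
    \<psi> + r \<psi>' is at least r h (2 F + r F'), which equals r h (\<open>vort r\<close> - 2
    \<open>lam\<close>).\<close>
  have m_R1: "0 < m R1"
  proof -
    have "0 < R1 * h R1 * (vort R1 - 2 * lam)"
      using F_R1 R0 a by (simp add: lam_def)
    also have "\<dots> = (R1 * F R1 * h R1) + (R1 * F R1 * h R1 + R1\<^sup>2 * angvel' a R1 * h R1)"
      using a by (simp add: angvel'_def F_def power2_eq_square field_simps)
    also have "\<dots> \<le> n * (R1 * F R1 * h R1) + flux R1"
    proof -
      have "1 * (R1 * F R1 * h R1) \<le> n * (R1 * F R1 * h R1)"
        using n F_R1 a by (intro mult_right_mono) auto
      moreover have "0 \<le> y R1 / (R1 * F R1)" using F_R1 a by simp
      ultimately show ?thesis by (simp add: flux_def)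
    qed
    finally show ?thesis using a n by (simp add: m_def)
  qed
  \<comment> \<open>If \<open>m\<close> stayed nonnegative, r^n \<psi> would not decrease and \<psi>
    would stay away from 0. But the derivative of \<open>m\<close> is a negative factor times \<psi>
    / F, and F vanishes at least linearly at \<open>R0\<close>, so \<open>m\<close> would fall below
    every bound like a logarithm.\<close>
  have "\<exists>r\<in>{R1<..<R0}. m r < 0"
  proof (rule ccontr)
    assume "\<not> (\<exists>r\<in>{R1<..<R0}. m r < 0)"
    then have m_nonneg: "0 \<le> m r" if "r \<in> {R1..<R0}" for r
      using that m_R1 by (cases "r = R1") (auto simp: not_less)
    have sub: "r \<in> {c<..<R0}" if "r \<in> {R1..<R0}" for r using that c a by auto
    define G where "G r = r ^ n * (r * F r * h r)" for r :: real
    have G_R1: "0 < G R1" using F_R1 a by (simp add: G_def)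
    have G_ge: "G R1 \<le> G r" if "r \<in> {R1..<R0}" for r
    proof (rule DERIV_nonneg_imp_nondecreasing[of R1 r G])
      fix s assume "R1 \<le> s" "s \<le> r"
      then have s: "s \<in> {R1..<R0}" using that by auto
      show "\<exists>z. (G has_real_derivative z) (at s) \<and> 0 \<le> z"
        using psi_der[OF sub[OF s]] m_nonneg[OF s] s a
        by (intro exI[of _ "2 * n * (s ^ n * s ^ n) * m s / s"]) (auto simp: G_def[abs_def])
    qed (use that in auto)
    have "continuous_on {R1..R0} (angvel' a)"
      using a by (intro continuous_at_imp_continuous_on ballI DERIV_isCont[OF angvel'_has_derivative]) auto
    then have "bounded (angvel' a ` {R1..R0})"
      by (intro compact_imp_bounded compact_continuous_image) auto
    then obtain C where C: "0 < C" "\<And>s. s \<in> {R1..R0} \<Longrightarrow> \<bar>angvel' a s\<bar> \<le> C"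
      unfolding bounded_pos by auto
    have F_le: "F r \<le> C * (R0 - r)" if "r \<in> {R1..<R0}" for r
    proof -
      have "\<exists>s. r < s \<and> s < R0 \<and> F R0 - F r = (R0 - r) * angvel' a s"
        by (rule MVT2) (use that a F_der in auto)
      then obtain s where "r < s" "s < R0" and s: "F R0 - F r = (R0 - r) * angvel' a s"
        by blast
      with that have "s \<in> {R1..R0}" by auto
      from s have "F r = (R0 - r) * (- angvel' a s)" by (simp add: F_def lam_def algebra_simps)
      also have "\<dots> \<le> (R0 - r) * C"
        using C(2)[OF \<open>s \<in> {R1..R0}\<close>] that by (intro mult_left_mono) auto
      finally show ?thesis by (simp add: mult.commute)
    qed
    define \<gamma> where "\<gamma> = 2 * R1 / (1 + R0\<^sup>2)\<^sup>2"
    have "0 < \<gamma>" using a by (simp add: \<gamma>_def)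
    have vort'_le: "vort' r \<le> - \<gamma>" if "r \<in> {R1..<R0}" for r
    proof -
      have "(1 + r\<^sup>2)\<^sup>2 \<le> (1 + R0\<^sup>2)\<^sup>2"
        using that a by (intro power_mono add_left_mono) auto
      then have "2 * R1 / (1 + R0\<^sup>2)\<^sup>2 \<le> 2 * r / (1 + r\<^sup>2)\<^sup>2"
        using that a by (intro frac_le) auto
      then show ?thesis by (simp add: vort'_def \<gamma>_def)
    qed
    \<comment> \<open>\<open>D\<close> collects the bounds on \<open>[R1, R0)\<close>:
      \<open>vort'\<close> at most - \<gamma>, \<open>G\<close> at least \<open>G R1\<close>, r at
      most \<open>R0\<close>, and F at most C (R0 - r).\<close>
    define D where "D = \<gamma> * G R1 / (R0 ^ n * R0 ^ n * C * (2 * n))"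
    have "0 < D" using \<open>0 < \<gamma>\<close> G_R1 C R0 a n by (simp add: D_def)
    have slope: "r * vort' r * h r / r ^ n / (2 * n) \<le> - D / (R0 - r)" if r: "r \<in> {R1..<R0}" for r
    proof -
      have pos: "0 < r" "0 < F r" using r a F_pos_right[of r] by auto
      have "D / (R0 - r) = \<gamma> * G R1 / (R0 ^ n * R0 ^ n * (C * (R0 - r)) * (2 * n))"
        by (simp add: D_def mult_ac)
      also have "\<dots> \<le> (- vort' r) * G r / (r ^ n * r ^ n * F r * (2 * n))"
        using vort'_le[OF r] G_ge[OF r] F_le[OF r] \<open>0 < \<gamma>\<close> G_R1 pos n r C(1)
        by (intro frac_le mult_mono power_mono mult_pos_pos mult_nonneg_nonneg) auto
      also have "\<dots> = - (r * vort' r * h r / r ^ n / (2 * n))"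
        using pos n by (simp add: G_def field_simps)
      finally show ?thesis by simp
    qed
    have descent: "m r - D * ln (R0 - r) \<le> m R1 - D * ln (R0 - R1)" if "r \<in> {R1..<R0}" for r
    proof (rule DERIV_nonpos_imp_nonincreasing[of R1 r "\<lambda>r. m r - D * ln (R0 - r)"])
      fix s assume "R1 \<le> s" "s \<le> r"
      then have s: "s \<in> {R1..<R0}" using that by auto
      have "((\<lambda>r. m r - D * ln (R0 - r)) has_real_derivative
          s * vort' s * h s / s ^ n / (2 * n) - D * (- 1 / (R0 - s))) (at s)"
        using s by (intro DERIV_diff DERIV_cmult m_der sub) (auto intro!: derivative_eq_intros)
      then show "\<exists>z. ((\<lambda>r. m r - D * ln (R0 - r)) has_real_derivative z) (at s) \<and> z \<le> 0"
        using slope[OF s] by (intro exI conjI) auto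
    qed (use that in auto)
    \<comment> \<open>At this point D ln (R0 - r) has dropped by \<open>m R1 + 1\<close> from its
      value at \<open>R1\<close>, so \<open>descent\<close> gives \<open>m r\<close> at most
      -1.\<close>
    define r where "r = R0 - (R0 - R1) * exp (- ((m R1 + 1) / D))"
    have "exp (- ((m R1 + 1) / D)) < 1" using m_R1 \<open>0 < D\<close> by simp
    then have "(R0 - R1) * exp (- ((m R1 + 1) / D)) < (R0 - R1) * 1"
      using R0 by (intro mult_strict_left_mono) auto
    moreover have "0 < (R0 - R1) * exp (- ((m R1 + 1) / D))"
      using R0 by simp
    ultimately have r: "r \<in> {R1..<R0}"
      by (auto simp: r_def)
    have "ln (R0 - r) = ln (R0 - R1) - (m R1 + 1) / D"
      using R0 by (simp add: r_def ln_mult)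
    then have "D * ln (R0 - r) = D * ln (R0 - R1) - (m R1 + 1)"
      using \<open>0 < D\<close> by (simp add: right_diff_distrib)
    with descent[OF r] m_nonneg[OF r] show False by linarith
  qed
  then obtain r1 where r1: "R1 < r1" "r1 < R0" "m r1 < 0" by auto
  have "\<exists>R\<ge>R1. R \<le> r1 \<and> m R = 0"
  proof (rule IVT2)
    show "\<forall>x. R1 \<le> x \<and> x \<le> r1 \<longrightarrow> isCont m x"
      using r1 a c by (auto intro!: DERIV_isCont[OF m_der])
  qed (use r1 m_R1 in auto)
  then obtain R where R: "R1 \<le> R" "R \<le> r1" "m R = 0" by auto
  show ?thesis
  proof (rule that[of R "{c<..<R0}" h lam])
    show "R1 < R" using R m_R1 by (cases "R1 = R") auto
    show "{a..R} \<subseteq> {c<..<R0}" using c R r1 by auto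
    show "0 < h r" if "r \<in> {a..R}" for r using h_ge[of r] that R r1 by auto
    fix r assume r: "r \<in> {a..R}"
    have sub: "s \<in> {c<..<R0}" if "s \<in> {a..R}" for s using that c R r1 by auto
    note vector_deriv = has_vector_derivative_at_within[OF iffD1[OF has_real_derivative_iff_has_vector_derivative]]
    have l_vec: "(l has_vector_derivative - (s ^ (n + 1) * vort' s * h s / (2 * n))) (at s within {a..r})"
      if "s \<in> {a..r}" for s
      by (rule vector_deriv[OF l_der[OF sub]]) (use that r in auto)
    have m_vec: "(m has_vector_derivative s * vort' s * h s / s ^ n / (2 * n)) (at s within {r..R})"
      if "s \<in> {r..R}" for s
      by (rule vector_deriv[OF m_der[OF sub]]) (use that r in auto)
    \<comment> \<open>Because \<open>l a = 0\<close> and \<open>m R = 0\<close>, integrating the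
      derivatives turns both moments into pure integrals; the splitting of \<psi> into the two
      moments then becomes the integral equation.\<close>
    have "((\<lambda>s. - (2 * n) * (- (s ^ (n + 1) * vort' s * h s / (2 * n)))) has_integral
        (- (2 * n) * (l r - l a))) {a..r}"
      by (intro has_integral_mult_right fundamental_theorem_of_calculus l_vec) (use r in auto)
    then have inner: "integral {a..r} (\<lambda>s. s ^ (n + 1) * vort' s * h s) = - (2 * n) * l r"
      using n l_a by (simp add: integral_unique)
    have "((\<lambda>s. (2 * n) * (s * vort' s * h s / s ^ n / (2 * n))) has_integral
        ((2 * n) * (m R - m r))) {r..R}"
      by (intro has_integral_mult_right fundamental_theorem_of_calculus m_vec) (use r in auto)
    then have outer: "integral {r..R} (\<lambda>s. s * vort' s * h s / s ^ n) = - (2 * n) * m r"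
      using n R by (simp add: integral_unique)
    have "l r / r ^ n + r ^ n * m r = r * F r * h r"
      using neq[OF sub[OF r]] n by (simp add: l_def m_def field_simps)
    then have "2 * n * (r * F r * h r) = 2 * n * (l r / r ^ n + r ^ n * m r)"
      by simp
    then show "2 * n * (r * (angvel a r - lam) * h r) =
      - (integral {a..r} (\<lambda>s. s ^ (n + 1) * vort' s * h s) / r ^ n
         + r ^ n * integral {r..R} (\<lambda>s. s * vort' s * h s / s ^ n))"
      unfolding inner outer F_def by (simp add: distrib_left mult_ac)
  qed (use smooth in auto)
qed

section \<open>The clipped profile\<close>

text \<open>Made for functions that may jump at \<open>a\<close> and \<open>b\<close>, as the
  clipped gradient does: Lebesgue integrals over larger sets reduce to gauge integrals over
  \<open>{a..b}\<close>.\<close>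

lemma set_integral_supported:
  fixes f :: "real \<Rightarrow> real"
  assumes cont: "continuous_on {a..b} f" and supp: "\<And>x. x \<notin> {a..b} \<Longrightarrow> f x = 0"
    and S: "S \<in> sets lebesgue"
  shows "integrable lebesgue f" "set_integrable lebesgue S f"
    and "{a..b} \<subseteq> S \<Longrightarrow> (LINT x:S|lebesgue. f x) = integral {a..b} f"
proof -
  have int: "set_integrable lebesgue {a..b} f"
    using absolutely_integrable_continuous_real[OF cont] .
  have restrict: "indicat_real T x * f x = f x" if "{a..b} \<subseteq> T" for T x
  proof (cases "x \<in> T")
    case False
    then have "f x = 0" using that by (intro supp) blast
    then show ?thesis by simp
  qed simp
  show "integrable lebesgue f"
    using int by (simp add: set_integrable_def restrict)
  then show "set_integrable lebesgue S f"
    unfolding set_integrable_def by (rule integrable_mult_indicator[OF S])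
  show "(LINT x:S|lebesgue. f x) = integral {a..b} f" if "{a..b} \<subseteq> S"
    using set_lebesgue_integral_eq_integral(2)[OF int]
    by (simp add: set_lebesgue_integral_def restrict that)
qed

section \<open>The kernel on both sides of the diagonal\<close>

lemma kernel_K_inner:
  assumes "0 < s" "s \<le> r"
  shows "kernel_K n (r / s) = s ^ (n + 1) / (2 * r * r ^ n)"
  using assms by (cases "s = r")
    (auto simp: kernel_K_def power_int_minus power_int_of_nat power_divide field_simps)

text \<open>At s = r both closed forms equal 1/2, so they may overlap there and the kernel is
  continuous in s.\<close>

lemma kernel_K_outer:
  assumes "0 < r" "r \<le> s"
  shows "kernel_K n (r / s) = s * r ^ n / (2 * r * s ^ n)"
  using assms by (auto simp: kernel_K_def power_divide)

lemma continuous_on_kernel_K: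
  assumes "0 < a" "0 < r"
  shows "continuous_on {a..b} (\<lambda>s. kernel_K n (r / s))"
proof -
  have "continuous_on {min a r..r} (\<lambda>s. kernel_K n (r / s))"
    by (rule continuous_on_eq[where f = "\<lambda>s. s ^ (n + 1) / (2 * r * r ^ n)"])
      (use assms in \<open>auto intro!: continuous_intros simp: kernel_K_inner simp del: power_Suc\<close>)
  moreover have "continuous_on {r..max b r} (\<lambda>s. kernel_K n (r / s))"
    by (rule continuous_on_eq[where f = "\<lambda>s. s * r ^ n / (2 * r * s ^ n)"])
      (use assms in \<open>auto intro!: continuous_intros simp: kernel_K_outer\<close>)
  ultimately have "continuous_on ({min a r..r} \<union> {r..max b r}) (\<lambda>s. kernel_K n (r / s))"
    by (intro continuous_on_closed_Un) auto
  then show ?thesis by (rule continuous_on_subset) auto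
qed

section \<open>The profile frozen on both sides and its weak derivative\<close>

definition clip_vort :: "real \<Rightarrow> real \<Rightarrow> real \<Rightarrow> real" where
  "clip_vort a b r = vort (max a (min r b))"

text \<open>Keeping both end points makes the gradient continuous on the closed interval, so
  integrals over \<open>{a..r}\<close> and \<open>{r..b}\<close> can be treated as those of
  \<open>vort'\<close>.\<close>

definition clip_vort' :: "real \<Rightarrow> real \<Rightarrow> real \<Rightarrow> real" where
  "clip_vort' a b r = (if r \<in> {a..b} then vort' r else 0)"

lemma continuous_on_vort: "continuous_on S vort"
  by (intro continuous_at_imp_continuous_on ballI DERIV_isCont[OF vort_has_derivative])

lemma continuous_on_vort': "continuous_on S vort'"
  unfolding vort'_def by (intro continuous_intros) auto

lemma continuous_on_clip_vort: "continuous_on S (clip_vort a b)"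
  unfolding clip_vort_def
  by (intro continuous_on_compose2[OF continuous_on_vort[of UNIV]] continuous_intros) auto

lemma continuous_on_clip_vort': "continuous_on {a..b} (clip_vort' a b)"
  by (rule continuous_on_eq[OF continuous_on_vort']) (simp add: clip_vort'_def)

lemma clip_vort_has_derivative:
  assumes "a < b" "x \<noteq> a" "x \<noteq> b"
  shows "(clip_vort a b has_real_derivative clip_vort' a b x) (at x)"
proof -
  consider "x < a" | "a < x" "x < b" | "b < x" using assms by linarith
  then show ?thesis
  proof cases
    case 1
    show ?thesis
      by (rule has_field_derivative_transform_within_open[of "\<lambda>_. vort a" _ x "{..<a}"])
        (use 1 assms in \<open>auto simp: clip_vort_def clip_vort'_def\<close>)
  next
    case 2
    show ?thesis
      by (rule has_field_derivative_transform_within_open[of vort _ x "{a<..<b}"])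
        (use 2 vort_has_derivative in \<open>auto simp: clip_vort_def clip_vort'_def\<close>)
  next
    case 3
    show ?thesis
      by (rule has_field_derivative_transform_within_open[of "\<lambda>_. vort b" _ x "{b<..}"])
        (use 3 assms in \<open>auto simp: clip_vort_def clip_vort'_def\<close>)
  qed
qed

lemma abs_vort'_le: "\<bar>vort' r\<bar> \<le> 1"
proof -
  have "2 * \<bar>r\<bar> \<le> 1 + r\<^sup>2"
    using sum_squares_bound[of 1 "\<bar>r\<bar>"] by simp
  also have "1 + r\<^sup>2 \<le> (1 + r\<^sup>2)\<^sup>2"
    using self_le_power[of "1 + r\<^sup>2" 2] by simp
  finally show ?thesis
    by (simp add: vort'_def abs_mult)
qed

lemma abs_vort_le: "\<bar>vort r\<bar> \<le> 1"
  by (simp add: vort_def)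

lemma abs_vort_diff_le: "\<bar>vort r - vort s\<bar> \<le> \<bar>r - s\<bar>"
  using field_differentiable_bound[of UNIV vort vort' 1 s r] vort_has_derivative abs_vort'_le
  by auto

lemma vort_antimono: "0 \<le> r \<Longrightarrow> r \<le> s \<Longrightarrow> vort s \<le> vort r"
  by (simp add: vort_def frac_le power_mono)

text \<open>The profile is continuous and differentiable except at \<open>a\<close> and
  \<open>b\<close>. The fundamental theorem with two exceptional points, applied to its product with
  \<phi>, leaves no boundary terms.\<close>

lemma clip_vort_weak_derivative:
  assumes ab: "0 < a" "a < b"
  shows "has_weak_derivative (clip_vort a b) (clip_vort' a b)"
proof -
  have supp: "clip_vort' a b x = 0" if "x \<notin> {a..b}" for x
    using that by (simp only: clip_vort'_def if_False)
  have "set_integrable lebesgue C (clip_vort a b)" if C: "compact C" for C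
  proof -
    obtain q where "C \<subseteq> {- q..q}"
      using bounded_subset_cbox_symmetric[OF compact_imp_bounded[OF C]] by auto
    then show ?thesis
      using absolutely_integrable_continuous_real[OF continuous_on_clip_vort] C
      by (elim set_integrable_subset[rotated 2]) (auto simp: lmeasurable_compact fmeasurableD)
  qed
  moreover have "set_integrable lebesgue C (clip_vort' a b)" if "compact C" for C
    using that
    by (intro set_integral_supported(2)[OF continuous_on_clip_vort' supp]) (auto simp: lmeasurable_compact fmeasurableD)
  moreover have "(LINT r:{0<..}|lebesgue. clip_vort a b r * deriv \<phi> r)
      = - (LINT r:{0<..}|lebesgue. clip_vort' a b r * \<phi> r)" if \<phi>: "test_function \<phi>" for \<phi>
  proof -
    from \<phi> obtain C where C: "compact C" "C \<subseteq> {0<..}" "\<And>x. x \<notin> C \<Longrightarrow> \<phi> x = 0"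
      by (auto simp: test_function_def)
    from \<phi> have diff: "(deriv ^^ k) \<phi> field_differentiable (at x)" for k x
      by (auto simp: test_function_def smooth_on_open_def)
    have \<phi>_der: "(\<phi> has_real_derivative deriv \<phi> x) (at x)" for x
      using diff[of 0 x] by (simp add: DERIV_deriv_iff_field_differentiable)
    have cont: "continuous_on S \<phi>" "continuous_on S (deriv \<phi>)" for S
      using diff[of 0] diff[of 1]
      by (auto intro!: continuous_at_imp_continuous_on field_differentiable_imp_continuous_at)
    have deriv_0: "deriv \<phi> x = 0" if "x \<notin> C" for x
    proof -
      have "(\<phi> has_real_derivative 0) (at x)"
        by (rule has_field_derivative_transform_within_open[of "\<lambda>_. 0" _ x "- C"])
          (use C that in \<open>auto simp: compact_imp_closed open_Compl\<close>)
      then show ?thesis by (rule DERIV_imp_deriv)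
    qed
    \<comment> \<open>With \<open>a\<close> and \<open>b\<close> inserted, the set is nonempty even
      for \<phi> = 0, and \<open>{p..q}\<close> contains both \<open>{a..b}\<close> and the support
      of \<phi>; halving the minimum keeps \<open>p\<close> positive and outside
      \<open>C\<close>.\<close>
    have "compact (insert a (insert b C))" using C by auto
    then obtain u v where uv: "u \<in> insert a (insert b C)" "v \<in> insert a (insert b C)"
      "\<And>x. x \<in> insert a (insert b C) \<Longrightarrow> u \<le> x \<and> x \<le> v"
      using compact_attains_inf[of "insert a (insert b C)"] compact_attains_sup[of "insert a (insert b C)"]
      by (metis insert_not_empty)
    define p where "p = u / 2"
    define q where "q = v + 1"
    have "0 < u" using uv(1) C(2) ab by auto
    have pq: "0 < p" "p < a" "b < q" "p \<notin> C" "q \<notin> C"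
      using \<open>0 < u\<close> uv(3)[of p] uv(3)[of q] uv(3)[of a] uv(3)[of b] by (auto simp: p_def q_def)
    have C_sub: "C \<subseteq> {p..q}"
      using uv(3) \<open>0 < u\<close> by (force simp: p_def q_def)
    have cont_prod: "continuous_on {p..q} (\<lambda>r. clip_vort a b r * deriv \<phi> r)"
      by (intro continuous_intros continuous_on_clip_vort cont)
    have cont_prod': "continuous_on {a..b} (\<lambda>r. clip_vort' a b r * \<phi> r)"
      by (intro continuous_intros continuous_on_clip_vort' cont)
    have supp': "clip_vort' a b r * \<phi> r = 0" if "r \<notin> {a..b}" for r
      using supp[OF that] by simp
    have left: "(LINT r:{0<..}|lebesgue. clip_vort a b r * deriv \<phi> r)
        = integral {p..q} (\<lambda>r. clip_vort a b r * deriv \<phi> r)"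
    proof (rule set_integral_supported(3)[OF cont_prod])
      fix r assume "r \<notin> {p..q}"
      with C_sub have "r \<notin> C" by blast
      then show "clip_vort a b r * deriv \<phi> r = 0" by (simp add: deriv_0)
    qed (use pq in auto)
    have "(LINT r:{p..q}|lebesgue. clip_vort' a b r * \<phi> r) = integral {a..b} (\<lambda>r. clip_vort' a b r * \<phi> r)"
      "(LINT r:{0<..}|lebesgue. clip_vort' a b r * \<phi> r) = integral {a..b} (\<lambda>r. clip_vort' a b r * \<phi> r)"
      by (rule set_integral_supported(3)[OF cont_prod' supp']; use ab pq in auto)+
    moreover note set_lebesgue_integral_eq_integral[OF set_integral_supported(2)[OF cont_prod' supp', of "{p..q}"]]
    ultimately have right: "(LINT r:{0<..}|lebesgue. clip_vort' a b r * \<phi> r)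
        = integral {p..q} (\<lambda>r. clip_vort' a b r * \<phi> r)"
      and right_int: "(\<lambda>r. clip_vort' a b r * \<phi> r) integrable_on {p..q}"
      by auto
    have "((\<lambda>r. clip_vort a b r * deriv \<phi> r + clip_vort' a b r * \<phi> r) has_integral
        clip_vort a b q * \<phi> q - clip_vort a b p * \<phi> p) {p..q}"
    proof (rule fundamental_theorem_of_calculus_interior_strong[of "{a, b}"])
      fix x assume "x \<in> {p<..<q} - {a, b}"
      then have "(clip_vort a b has_real_derivative clip_vort' a b x) (at x)"
        using clip_vort_has_derivative ab by auto
      from DERIV_mult[OF this \<phi>_der]
      show "((\<lambda>r. clip_vort a b r * \<phi> r) has_vector_derivative
          clip_vort a b x * deriv \<phi> x + clip_vort' a b x * \<phi> x) (at x)"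
        by (simp add: has_real_derivative_iff_has_vector_derivative algebra_simps)
    qed (use pq ab in \<open>auto intro!: continuous_intros continuous_on_clip_vort cont\<close>)
    then have "integral {p..q} (\<lambda>r. clip_vort a b r * deriv \<phi> r + clip_vort' a b r * \<phi> r) = 0"
      using C(3) pq by (simp add: integral_unique)
    moreover have "integral {p..q} (\<lambda>r. clip_vort a b r * deriv \<phi> r + clip_vort' a b r * \<phi> r)
      = integral {p..q} (\<lambda>r. clip_vort a b r * deriv \<phi> r) + integral {p..q} (\<lambda>r. clip_vort' a b r * \<phi> r)"
      by (intro Henstock_Kurzweil_Integration.integral_add right_int integrable_continuous_interval cont_prod)
    ultimately show ?thesis unfolding left right by linarith
  qed
  ultimately show ?thesis
    by (auto simp: has_weak_derivative_def locally_integrable_def)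
qed

lemma clip_vort_W_1_infinity:
  assumes ab: "0 < a" "a < b"
  shows "clip_vort a b \<in> W_1_infinity"
proof -
  have "clip_vort a b \<in> L_infinity"
    unfolding L_infinity_def using abs_vort_le
    by (auto intro!: continuous_imp_measurable_on_sets_lebesgue continuous_on_clip_vort AE_I2 exI[of _ 1]
        simp: clip_vort_def)
  moreover have "clip_vort' a b \<in> L_infinity"
  proof -
    have "integrable lebesgue (clip_vort' a b)"
      by (rule set_integral_supported(1)[OF continuous_on_clip_vort', of a b UNIV]) (auto simp: clip_vort'_def)
    then have "clip_vort' a b \<in> borel_measurable (lebesgue_on {0..})"
      by (intro measurable_restrict_space1 borel_measurable_integrable)
    moreover have "\<bar>clip_vort' a b r\<bar> \<le> 1" for r
      using abs_vort'_le[of r] by (simp add: clip_vort'_def)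
    ultimately show ?thesis
      unfolding L_infinity_def by (auto intro!: AE_I2 exI[of _ 1])
  qed
  ultimately show ?thesis
    using clip_vort_weak_derivative[OF ab] by (auto simp: W_1_infinity_def)
qed

text \<open>The midpoint later witnesses that the mode is nonzero somewhere on the support. It
  belongs to the support because \<open>vort'\<close> is negative on \<open>{a<..<b}\<close> and
  nonempty open sets are not null.\<close>

lemma ess_support_clip_vort':
  assumes ab: "0 < a" "a < b"
  shows "ess_support (clip_vort' a b) \<subseteq> {a..b}" "(a + b) / 2 \<in> ess_support (clip_vort' a b)"
proof -
  show "ess_support (clip_vort' a b) \<subseteq> {a..b}"
  proof
    fix r assume r: "r \<in> ess_support (clip_vort' a b)"
    show "r \<in> {a..b}"
    proof (rule ccontr)
      assume "r \<notin> {a..b}"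
      then have "r \<in> - {a..b}" "open (- {a..b})" by (auto intro: open_Compl)
      moreover have "AE s in lebesgue_on {0..}. s \<in> - {a..b} \<longrightarrow> clip_vort' a b s = 0"
        by (auto simp: clip_vort'_def)
      ultimately show False using r by (auto simp: ess_support_def)
    qed
  qed
  have "\<not> (AE s in lebesgue_on {0..}. s \<in> U \<longrightarrow> clip_vort' a b s = 0)"
    if U: "open U" "(a + b) / 2 \<in> U" for U
  proof
    assume "AE s in lebesgue_on {0..}. s \<in> U \<longrightarrow> clip_vort' a b s = 0"
    then have "AE s in lebesgue. s \<in> {0..} \<longrightarrow> s \<in> U \<longrightarrow> clip_vort' a b s = 0"
      by (subst (asm) AE_restrict_space_iff) auto
    then have "AE s in lebesgue. s \<notin> U \<inter> {a<..<b}"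
    proof (rule AE_mp, intro AE_I2 impI notI)
      fix s assume "s \<in> {0..} \<longrightarrow> s \<in> U \<longrightarrow> clip_vort' a b s = 0" "s \<in> U \<inter> {a<..<b}"
      then show False using vort'_neg[of s] ab by (auto simp: clip_vort'_def)
    qed
    moreover have "open (U \<inter> {a<..<b})" using U by auto
    ultimately have "negligible (U \<inter> {a<..<b})"
      by (subst negligible_iff_null_sets) (subst AE_iff_null_sets, auto intro!: lborelD)
    moreover have "(a + b) / 2 \<in> U \<inter> {a<..<b}" using U ab by auto
    ultimately show False
      using open_not_negligible[OF \<open>open (U \<inter> {a<..<b})\<close>] by blast
  qed
  then show "(a + b) / 2 \<in> ess_support (clip_vort' a b)"
    using ab by (auto simp: ess_support_def)
qed

text \<open>Interpolation: points at distance at most \<eta> are compared by the Lipschitz bound,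
  all others by the sup bound.\<close>

lemma holder_norm_le:
  assumes bound: "\<And>r. 0 \<le> r \<Longrightarrow> \<bar>f r\<bar> \<le> \<eta>"
    and lip: "\<And>r s. 0 \<le> r \<Longrightarrow> 0 \<le> s \<Longrightarrow> \<bar>f r - f s\<bar> \<le> 2 * \<bar>r - s\<bar>"
    and \<alpha>: "0 < \<alpha>" "\<alpha> < 1" and "0 < \<eta>"
  shows "holder_norm \<alpha> f \<le> ennreal (\<eta> + 2 * \<eta> powr (1 - \<alpha>))"
proof -
  have "\<bar>f r - f s\<bar> / \<bar>r - s\<bar> powr \<alpha> \<le> 2 * \<eta> powr (1 - \<alpha>)" if rs: "0 \<le> r" "0 \<le> s" "r \<noteq> s" for r s
  proof (cases "\<bar>r - s\<bar> \<le> \<eta>")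
    case True
    have "\<bar>f r - f s\<bar> / \<bar>r - s\<bar> powr \<alpha> \<le> 2 * (\<bar>r - s\<bar> / \<bar>r - s\<bar> powr \<alpha>)"
      using divide_right_mono[OF lip[OF rs(1,2)], of "\<bar>r - s\<bar> powr \<alpha>"] by simp
    also have "\<bar>r - s\<bar> / \<bar>r - s\<bar> powr \<alpha> = \<bar>r - s\<bar> powr (1 - \<alpha>)"
      using rs by (simp add: powr_diff)
    also have "\<dots> \<le> \<eta> powr (1 - \<alpha>)"
      using True \<alpha> by (intro powr_mono2) auto
    finally show ?thesis by simp
  next
    case False
    have "\<bar>f r - f s\<bar> / \<bar>r - s\<bar> powr \<alpha> \<le> 2 * \<eta> / \<eta> powr \<alpha>"
      using bound[OF rs(1)] bound[OF rs(2)] False \<alpha> \<open>0 < \<eta>\<close>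
      by (intro frac_le powr_mono2) auto
    also have "\<dots> = 2 * \<eta> powr (1 - \<alpha>)"
      using \<open>0 < \<eta>\<close> by (simp add: powr_diff)
    finally show ?thesis .
  qed
  then have "holder_norm \<alpha> f \<le> ennreal \<eta> + ennreal (2 * \<eta> powr (1 - \<alpha>))"
    unfolding holder_norm_def using bound
    by (intro add_mono SUP_least) (auto intro!: ennreal_leI)
  also have "\<dots> = ennreal (\<eta> + 2 * \<eta> powr (1 - \<alpha>))"
    using \<open>0 < \<eta>\<close> by (subst ennreal_plus) auto
  finally show ?thesis .
qed

text \<open>Freezing changes the profile by at most 1 - \<open>vort a\<close> below \<open>a\<close>
  and by at most \<open>vort b\<close> above \<open>b\<close>. Clipping does not increase distances,
  so both profiles have Lipschitz constant 1.\<close>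

lemma clip_vort_holder_norm_le:
  assumes ab: "0 < a" "a < b" "a\<^sup>2 \<le> \<eta>" "vort b \<le> \<eta>" and \<alpha>: "0 < \<alpha>" "\<alpha> < 1"
  shows "holder_norm \<alpha> (\<lambda>r. 1 / (1 + r\<^sup>2) - clip_vort a b r) \<le> ennreal (\<eta> + 2 * \<eta> powr (1 - \<alpha>))"
proof (rule holder_norm_le)
  show "0 < \<eta>" using ab by (meson less_le_trans zero_less_power)
  fix r :: real assume r: "0 \<le> r"
  have vort_a: "1 - vort a \<le> a\<^sup>2" by (simp add: vort_def field_simps)
  have vort_01: "0 \<le> vort s" "vort s \<le> 1" for s by (simp_all add: vort_def)
  consider "r \<le> a" | "a \<le> r" "r \<le> b" | "b \<le> r" by linarith
  then show "\<bar>1 / (1 + r\<^sup>2) - clip_vort a b r\<bar> \<le> \<eta>"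
    unfolding vort_def[symmetric]
  proof cases
    case 1
    then have "clip_vort a b r = vort a" using ab by (simp add: clip_vort_def)
    then show "\<bar>vort r - clip_vort a b r\<bar> \<le> \<eta>"
      using vort_antimono[OF r 1] vort_01[of r] vort_a ab by simp
  next
    case 2
    then show "\<bar>vort r - clip_vort a b r\<bar> \<le> \<eta>" using \<open>0 < \<eta>\<close> by (simp add: clip_vort_def)
  next
    case 3
    then have "clip_vort a b r = vort b" using ab by (simp add: clip_vort_def)
    then show "\<bar>vort r - clip_vort a b r\<bar> \<le> \<eta>"
      using vort_antimono[of b r] 3 vort_01[of r] ab by simp
  qed
next
  fix r s :: real
  have "\<bar>clip_vort a b r - clip_vort a b s\<bar> \<le> \<bar>max a (min r b) - max a (min s b)\<bar>"
    unfolding clip_vort_def by (rule abs_vort_diff_le)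
  also have "\<dots> \<le> \<bar>r - s\<bar>" by linarith
  finally show "\<bar>(1 / (1 + r\<^sup>2) - clip_vort a b r) - (1 / (1 + s\<^sup>2) - clip_vort a b s)\<bar> \<le> 2 * \<bar>r - s\<bar>"
    using abs_vort_diff_le[of r s]
      abs_triangle_ineq4[of "vort r - vort s" "clip_vort a b r - clip_vort a b s"]
    unfolding vort_def[symmetric] by (simp add: algebra_simps)
qed (use \<alpha> in auto)

text \<open>Serves both integrals of the problem: \<open>c_coeff\<close> with \<open>n\<close> = 1
  and \<open>f\<close> = 1, and \<open>interaction\<close> with \<open>f\<close> the mode.\<close>

lemma kernel_integral_split:
  fixes f :: "real \<Rightarrow> real"
  assumes r: "0 < a" "r \<in> {a..b}" and f: "continuous_on {a..b} f"
  shows "set_integrable lebesgue {0..} (\<lambda>s. clip_vort' a b s * kernel_K n (r / s) * f s)" (is ?int)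
    and "(LINT s:{0..}|lebesgue. clip_vort' a b s * kernel_K n (r / s) * f s) =
      (integral {a..r} (\<lambda>s. s ^ (n + 1) * vort' s * f s) / r ^ n
        + r ^ n * integral {r..b} (\<lambda>s. s * vort' s * f s / s ^ n)) / (2 * r)" (is ?eq)
proof -
  let ?k = "\<lambda>s. clip_vort' a b s * kernel_K n (r / s) * f s"
  have cont: "continuous_on {a..b} ?k"
    using r by (intro continuous_on_mult continuous_on_clip_vort' continuous_on_kernel_K f) auto
  have supp: "?k s = 0" if "s \<notin> {a..b}" for s
    using that by (simp only: clip_vort'_def if_False mult_zero_left)
  show ?int by (rule set_integral_supported(2)[OF cont supp]) auto
  have "(LINT s:{0..}|lebesgue. ?k s) = integral {a..b} ?k"
    by (rule set_integral_supported(3)[OF cont supp]) (use r in auto)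
  also have "\<dots> = integral {a..r} ?k + integral {r..b} ?k"
    using r by (intro Henstock_Kurzweil_Integration.integral_combine[symmetric] integrable_continuous_interval cont) auto
  also have "integral {a..r} ?k = integral {a..r} (\<lambda>s. (1 / (2 * r * r ^ n)) * (s ^ (n + 1) * vort' s * f s))"
    using r by (intro integral_cong) (auto simp: kernel_K_inner clip_vort'_def)
  also have "\<dots> = (1 / (2 * r * r ^ n)) * integral {a..r} (\<lambda>s. s ^ (n + 1) * vort' s * f s)"
    by (rule integral_mult_right)
  also have "integral {r..b} ?k = integral {r..b} (\<lambda>s. (r ^ n / (2 * r)) * (s * vort' s * f s / s ^ n))"
    using r by (intro integral_cong) (auto simp: kernel_K_outer clip_vort'_def)
  also have "\<dots> = (r ^ n / (2 * r)) * integral {r..b} (\<lambda>s. s * vort' s * f s / s ^ n)"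
    by (rule integral_mult_right)
  finally show ?eq using r by (simp add: field_simps)
qed

lemma c_coeff_clip_vort':
  assumes r: "0 < a" "r \<in> {a..b}"
  shows "set_integrable lebesgue {0..} (c_integrand (clip_vort' a b) r)"
    and "c_coeff (clip_vort' a b) r = vort b / 2 - angvel a r"
proof -
  note split = kernel_integral_split[OF r continuous_on_const[of _ 1], of 1]
  show "set_integrable lebesgue {0..} (c_integrand (clip_vort' a b) r)"
    using split(1) by (simp add: c_integrand_def[abs_def])
  have "((\<lambda>s. s\<^sup>2 * vort' s) has_integral
      r\<^sup>2 * (vort r - 2 * angvel a r) - a\<^sup>2 * (vort a - 2 * angvel a a)) {a..r}"
    by (rule fundamental_theorem_of_calculus)
      (use r in \<open>auto intro!: has_field_derivative_at_within vort_deficit_has_derivative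
        simp: has_real_derivative_iff_has_vector_derivative[symmetric]\<close>)
  moreover have "vort a - 2 * angvel a a = 0"
    using angvel'_self[OF r(1)] r by (simp add: angvel'_def)
  ultimately have inner: "integral {a..r} (\<lambda>s. s ^ (1 + 1) * vort' s * 1) = r\<^sup>2 * (vort r - 2 * angvel a r)"
    by (simp add: integral_unique power2_eq_square)
  have "(vort' has_integral vort b - vort r) {r..b}"
    by (rule fundamental_theorem_of_calculus)
      (use r in \<open>auto intro!: has_field_derivative_at_within vort_has_derivative
        simp: has_real_derivative_iff_has_vector_derivative[symmetric]\<close>)
  moreover have "integral {r..b} (\<lambda>s. s * vort' s * 1 / s ^ 1) = integral {r..b} vort'"
    using r by (intro integral_cong) auto
  ultimately have outer: "integral {r..b} (\<lambda>s. s * vort' s * 1 / s ^ 1) = vort b - vort r"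
    by (simp add: integral_unique)
  have coeff: "c_coeff (clip_vort' a b) r = (integral {a..r} (\<lambda>s. s ^ (1 + 1) * vort' s * 1) / r ^ 1
        + r ^ 1 * integral {r..b} (\<lambda>s. s * vort' s * 1 / s ^ 1)) / (2 * r)"
    using split(2) by (simp add: c_coeff_def c_integrand_def)
  have "0 < r" using r by auto
  then show "c_coeff (clip_vort' a b) r = vort b / 2 - angvel a r"
    unfolding coeff inner outer by (simp add: power2_eq_square field_simps)
qed

section \<open>Choice of the parameters and conclusion\<close>

theorem theorem1p1:
  shows "\<exists>n0\<ge>1. \<forall>n\<ge>n0. \<forall>\<alpha>::real. 0 < \<alpha> \<and> \<alpha> < 1 \<longrightarrow>
    (\<forall>\<epsilon>::real. \<epsilon> > 0 \<longrightarrow>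
      (\<exists>(\<omega> :: real \<Rightarrow> real) (\<omega>' :: real \<Rightarrow> real) (lam :: real) (h :: real \<Rightarrow> real).
         \<omega> \<in> W_1_infinity \<and>
         has_weak_derivative \<omega> \<omega>' \<and>
         h \<in> C_infinity (ess_support \<omega>') \<and>
         (\<exists>r\<in>ess_support \<omega>'. h r \<noteq> 0) \<and>
         (\<forall>r\<in>ess_support \<omega>'.
            set_integrable lebesgue {0..} (c_integrand \<omega>' r) \<and>
            set_integrable lebesgue {0..} (interaction_integrand n \<omega>' h r) \<and>
            (lam + c_coeff \<omega>' r) * h r - 1 / real n * interaction n \<omega>' h r = 0) \<and>
         holder_norm \<alpha> (\<lambda>r. 1 / (1 + r\<^sup>2) - \<omega> r) \<le> ennreal \<epsilon>))"
proof (intro exI[of _ "1::nat"] conjI allI impI)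
  fix n :: nat and \<alpha> \<epsilon> :: real
  assume n: "1 \<le> n" and \<alpha>: "0 < \<alpha> \<and> \<alpha> < 1" and \<epsilon>: "0 < \<epsilon>"
  \<comment> \<open>The first entry makes the sup norm, the second the Hoelder seminorm, at most
    \<epsilon> / 2.\<close>
  define \<eta> where "\<eta> = min (\<epsilon> / 2) ((\<epsilon> / 4) powr (1 / (1 - \<alpha>)))"
  have \<eta>: "0 < \<eta>" using \<epsilon> by (simp add: \<eta>_def)
  have "\<eta> powr (1 - \<alpha>) \<le> ((\<epsilon> / 4) powr (1 / (1 - \<alpha>))) powr (1 - \<alpha>)"
    using \<alpha> \<eta> by (intro powr_mono2) (auto simp: \<eta>_def)
  then have "\<eta> powr (1 - \<alpha>) \<le> \<epsilon> / 4"
    using \<alpha> \<epsilon> by (simp add: powr_powr)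
  moreover have "\<eta> \<le> \<epsilon> / 2" by (simp add: \<eta>_def)
  ultimately have small: "\<eta> + 2 * \<eta> powr (1 - \<alpha>) \<le> \<epsilon>" by linarith
  define a where "a = sqrt \<eta>"
  have a: "0 < a" "a\<^sup>2 \<le> \<eta>" using \<eta> by (simp_all add: a_def)
  \<comment> \<open>The summand 1 / a forces \<open>vort b\<close> below a^2 = \<eta> for b >
    \<open>R1\<close>; the summand \<open>a\<close> ensures \<open>a < R1\<close>.\<close>
  define R1 where "R1 = a + 1 / a"
  have "a < R1" using a by (simp add: R1_def)
  obtain lam b h U where
    b: "R1 < b" and U: "open U" "{a..b} \<subseteq> U" "smooth_on_open U h"
    and h_pos: "\<And>r. r \<in> {a..b} \<Longrightarrow> 0 < h r"
    and mode: "\<And>r. r \<in> {a..b} \<Longrightarrow> 2 * n * (r * (angvel a r - lam) * h r) =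
      - (integral {a..r} (\<lambda>s. s ^ (n + 1) * vort' s * h s) / r ^ n
         + r ^ n * integral {r..b} (\<lambda>s. s * vort' s * h s / s ^ n))"
    by (rule neutral_mode_exists[OF n a(1) \<open>a < R1\<close>]) (rule that)
  have ab: "0 < a" "a < b" using a b \<open>a < R1\<close> by auto
  have "vort b \<le> \<eta>"
  proof -
    have "1 / a \<le> b" using b ab by (simp add: R1_def)
    then have "(1 / a)\<^sup>2 \<le> b\<^sup>2" using ab by (intro power_mono) auto
    then have "1 / \<eta> \<le> 1 + b\<^sup>2" using \<eta> by (simp add: a_def power_divide)
    then show ?thesis using \<eta> by (simp add: vort_def field_simps)
  qed
  note sub = subsetD[OF ess_support_clip_vort'(1)[OF ab]]
  have h_cont: "continuous_on {a..b} h"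
  proof -
    have "h field_differentiable (at x)" if "x \<in> U" for x
      using U(3) that unfolding smooth_on_open_def by (metis funpow_0)
    then show ?thesis
      using U(2) by (intro continuous_at_imp_continuous_on ballI field_differentiable_imp_continuous_at) auto
  qed
  \<comment> \<open>The shift by \<open>vort b / 2\<close> cancels the constant in
    \<open>c_coeff\<close>, leaving \<open>lam - angvel a r\<close> as the factor of
    \<open>h r\<close>.\<close>
  have equation: "(lam - vort b / 2 + c_coeff (clip_vort' a b) r) * h r
      - 1 / real n * interaction n (clip_vort' a b) h r = 0" if r: "r \<in> {a..b}" for r
  proof -
    have "interaction n (clip_vort' a b) h r = - (2 * n * (r * (angvel a r - lam) * h r)) / (2 * r)"
      using kernel_integral_split(2)[OF ab(1) r h_cont, of n] mode[OF r]
      by (simp add: interaction_def interaction_integrand_def[abs_def])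
    also have "\<dots> = real n * ((lam - angvel a r) * h r)"
      using r ab by (simp add: field_simps)
    finally show ?thesis
      using n c_coeff_clip_vort'(2)[OF ab(1) r] by simp
  qed
  show "\<exists>\<omega> \<omega>' lam h. \<omega> \<in> W_1_infinity \<and> has_weak_derivative \<omega> \<omega>' \<and> h \<in> C_infinity (ess_support \<omega>') \<and>
         (\<exists>r\<in>ess_support \<omega>'. h r \<noteq> 0) \<and>
         (\<forall>r\<in>ess_support \<omega>'.
            set_integrable lebesgue {0..} (c_integrand \<omega>' r) \<and>
            set_integrable lebesgue {0..} (interaction_integrand n \<omega>' h r) \<and>
            (lam + c_coeff \<omega>' r) * h r - 1 / real n * interaction n \<omega>' h r = 0) \<and>
         holder_norm \<alpha> (\<lambda>r. 1 / (1 + r\<^sup>2) - \<omega> r) \<le> ennreal \<epsilon>"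
  proof (rule exI[of _ "clip_vort a b"], rule exI[of _ "clip_vort' a b"],
      rule exI[of _ "lam - vort b / 2"], rule exI[of _ h], intro conjI ballI)
    show "clip_vort a b \<in> W_1_infinity" by (rule clip_vort_W_1_infinity[OF ab])
    show "has_weak_derivative (clip_vort a b) (clip_vort' a b)" by (rule clip_vort_weak_derivative[OF ab])
    show "h \<in> C_infinity (ess_support (clip_vort' a b))"
      using U ess_support_clip_vort'(1)[OF ab] unfolding C_infinity_def by blast
    show "\<exists>r\<in>ess_support (clip_vort' a b). h r \<noteq> 0"
      using h_pos[of "(a + b) / 2"] ab by (intro bexI[OF _ ess_support_clip_vort'(2)[OF ab]]) auto
    show "holder_norm \<alpha> (\<lambda>r. 1 / (1 + r\<^sup>2) - clip_vort a b r) \<le> ennreal \<epsilon>"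
      using clip_vort_holder_norm_le[OF ab a(2) \<open>vort b \<le> \<eta>\<close>, of \<alpha>] \<alpha> small
      by (meson ennreal_leI order_trans)
  next
    fix r assume "r \<in> ess_support (clip_vort' a b)"
    then have r: "r \<in> {a..b}" by (rule sub)
    show "set_integrable lebesgue {0..} (c_integrand (clip_vort' a b) r)"
      by (rule c_coeff_clip_vort'(1)[OF ab(1) r])
    show "set_integrable lebesgue {0..} (interaction_integrand n (clip_vort' a b) h r)"
      using kernel_integral_split(1)[OF ab(1) r h_cont, of n] by (simp add: interaction_integrand_def[abs_def])
    show "(lam - vort b / 2 + c_coeff (clip_vort' a b) r) * h r
      - 1 / real n * interaction n (clip_vort' a b) h r = 0"
      by (rule equation[OF r])
  qed
qed simp

end
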